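(* Consider semi-restricted Rock, Paper, Scissors over $3n$ rounds. Suppose that $\mathsf R$ uses the greedy strategy, and that $\mathsf N$ uses, for each $n$, any non-stupid strategy. Let $T_0:=3n-3\lceil n^{2/3}\rceil$, let $S(t)$ be the score of $\mathsf N$ after round $t$, and let $S_n:=S(3n)$. In the decomposition $$n^{-1/2}S_n = n^{-1/2}S(T_0)+n^{-1/2}\bigl(S_n-S(T_0)\bigr),$$ the two terms on the right-hand side individually converge in distribution as $n\to\infty$: $$n^{-1/2}S(T_0)\overset{\mathrm d}{\longrightarrow} W,\qquad n^{-1/2}\bigl(S_n-S(T_0)\bigr)\overset{\mathrm d}{\longrightarrow} Z_{\max}:=\max\{Z_1,Z_2,Z_3\},$$ where $W\sim N(0,2)$ and $$(Z_1,Z_2,Z_3)\sim N\left(0,\begin{pmatrix}2&-1&-1\\-1&2&-1\\-1&-1&2\end{pmatrix}\right).$$ However, in general the two terms are dependent, so that $n^{-1/2}S_n$ need not converge in distribution to $W+Z_{\max}$ with $W$ and $Z_{\max}$ independent; that is, there is a choice of non-stupid strategies for $\mathsf N$ (one for each $n$) for which the two terms are dependent and this convergence fails.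
   Context: Semi-restricted Rock, Paper, Scissors over $3n$ rounds: there are two players, $\mathsf R$ (restricted) and $\mathsf N$ (normal), and three moves rock, paper, scissors, numbered $1,2,3$, where move $i+1$ beats move $i$ (indices mod 3). In each of $3n$ rounds both players simultaneously choose a move, knowing all moves made in earlier rounds; choices may be randomized (and, given the history, the two players' choices in a round are independent). $\mathsf R$ must choose each of the three moves exactly $n$ times during the $3n$ rounds; $\mathsf N$ is unrestricted. A round in which both select the same move is a draw. The score $S(t)$ of $\mathsf N$ after round $t$ is the number of rounds among the first $t$ won by $\mathsf N$ minus the number of those won by $\mathsf R$. Greedy strategy of $\mathsf R$ (with fresh independent randomness in each round): if $\mathsf R$ still has all three moves available, she chooses each with probability $1/3$; if she has exactly two moves available, say $i$ and $i+1$ (mod 3), she plays $i$ with probability $1/3$ and $i+1$ with probability $2/3$; if she has only one move available she plays it. (This is the optimal strategy of $\mathsf R$ for the expected final score.) A strategy of $\mathsf N$ (possibly randomized and dependent on the history of the game) is non-stupid if it never makes a move that cannot win when $\mathsf R$ has only one or two moves available. That is: when $\mathsf R$ has exactly the moves $i,i+1$ (mod 3) available, $\mathsf N$ plays only $i+1$ or $i+2$; when $\mathsf R$ has only the move $i$ available, $\mathsf N$ plays $i+1$. There is no restriction on $\mathsf N$ while $\mathsf R$ has all three moves available. $N(0,\Sigma)$ denotes the (possibly degenerate) normal distribution with mean $0$ and variance, or covariance matrix, $\Sigma$. *)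

theory Defs
  imports "HOL-Probability.Probability"
begin

text \<open>Moves are the elements of \<open>3\<close>, the integers modulo 3 (so move number 3 is \<open>0\<close>).
  A history lists the rounds in order; each round is (move of R, move of N).\<close>

type_synonym move = 3
type_synonym history = "(move \<times> move) list"
type_synonym strategy = "history \<Rightarrow> move pmf"

definition round_score :: "move \<times> move \<Rightarrow> int" where
  "round_score = (\<lambda>(r, s). if s = r + 1 then 1 else if r = s + 1 then -1 else 0)"

definition score :: "history \<Rightarrow> nat \<Rightarrow> int" where
  "score h t = (\<Sum>m\<leftarrow>take t h. round_score m)"

definition available :: "nat \<Rightarrow> history \<Rightarrow> move set" where
  "available n h = {i. count_list (map fst h) i < n}"

text \<open>Given the history, the two players choose independently.\<close>

primrec play :: "strategy \<Rightarrow> strategy \<Rightarrow> nat \<Rightarrow> history pmf" where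
  "play \<rho> \<sigma> 0 = return_pmf []"
| "play \<rho> \<sigma> (Suc t) =
     bind_pmf (play \<rho> \<sigma> t) (\<lambda>h. map_pmf (\<lambda>m. h @ [m]) (pair_pmf (\<rho> h) (\<sigma> h)))"

text \<open>Every two-element set of moves is \<open>{i, i + 1}\<close> for exactly one \<open>i\<close>. With three moves
  or one move available, \<open>pmf_of_set\<close> gives the uniform choice or the forced move. The set of
  available moves is never empty before the end of round \<open>3n\<close>.\<close>

definition greedy :: "nat \<Rightarrow> strategy" where
  "greedy n h = (let A = available n h in
     if card A = 2
     then (let i = (THE i. A = {i, i + 1}) in
           map_pmf (\<lambda>b. if b then i else i + 1) (bernoulli_pmf (1 / 3)))
     else pmf_of_set A)"

text \<open>The histories possible for R: no move has been used more than \<open>n\<close> times by R.\<close>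

definition legal_history :: "nat \<Rightarrow> history \<Rightarrow> bool" where
  "legal_history n h \<longleftrightarrow> (\<forall>i. count_list (map fst h) i \<le> n)"

definition non_stupid :: "nat \<Rightarrow> strategy \<Rightarrow> bool" where
  "non_stupid n \<sigma> \<longleftrightarrow>
     (\<forall>h. length h < 3 * n \<and> legal_history n h \<longrightarrow>
        (\<forall>i. available n h = {i, i + 1} \<longrightarrow> set_pmf (\<sigma> h) \<subseteq> {i + 1, i + 2}) \<and>
        (\<forall>i. available n h = {i} \<longrightarrow> set_pmf (\<sigma> h) \<subseteq> {i + 1}))"

text \<open>The probability space of complete games when R plays greedily; \<open>S(t)\<close> is
  \<open>\<lambda>h. score h t\<close> on it.\<close>

definition greedy_game :: "nat \<Rightarrow> strategy \<Rightarrow> history measure" where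
  "greedy_game n \<sigma> = measure_pmf (play (greedy n) \<sigma> (3 * n))"

definition T0 :: "nat \<Rightarrow> nat" where
  "T0 n = 3 * n - 3 * nat \<lceil>real n powr (2 / 3)\<rceil>"

definition early_score :: "nat \<Rightarrow> history \<Rightarrow> real" where
  "early_score n h = real_of_int (score h (T0 n)) / sqrt (real n)"

definition late_score :: "nat \<Rightarrow> history \<Rightarrow> real" where
  "late_score n h = real_of_int (score h (3 * n) - score h (T0 n)) / sqrt (real n)"

definition total_score :: "nat \<Rightarrow> history \<Rightarrow> real" where
  "total_score n h = real_of_int (score h (3 * n)) / sqrt (real n)"


text \<open>The centred, possibly degenerate, normal law with covariance matrix \<open>\<Sigma>\<close> is the law of
  \<open>A X\<close>, where \<open>X\<close> has independent standard normal components and \<open>A\<close> is the positive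
  semidefinite square root of \<open>\<Sigma>\<close>.\<close>

definition psd_sqrt :: "real^'n^'n \<Rightarrow> real^'n^'n" where
  "psd_sqrt \<Sigma> = (THE A. transpose A = A \<and> (\<forall>x. 0 \<le> x \<bullet> (A *v x)) \<and> A ** A = \<Sigma>)"

definition mv_normal :: "real^'n^'n \<Rightarrow> (real^'n) measure" where
  "mv_normal \<Sigma> = distr (Pi\<^sub>M UNIV (\<lambda>_. density lborel std_normal_density)) borel
     (\<lambda>x. psd_sqrt \<Sigma> *v (\<chi> i. x i))"

definition Z_cov :: "real^3^3" where
  "Z_cov = (\<chi> i j. if i = j then 2 else -1)"

definition W_law :: "real measure" where
  "W_law = density lborel (normal_density 0 (sqrt 2))"

definition Zmax_law :: "real measure" where
  "Zmax_law = distr (mv_normal Z_cov) borel (\<lambda>z. Max (range (\<lambda>i. z $ i)))"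

text \<open>The definite description in \<open>psd_sqrt\<close> is satisfied, uniquely, for \<open>Z_cov\<close>.\<close>

lemma Z_cov_squared: "Z_cov ** Z_cov = 3 *\<^sub>R Z_cov"
  unfolding Z_cov_def matrix_matrix_mult_def
  by (simp add: vec_eq_iff forall_3 sum_3)

lemma psd_sqrt_Z_cov: "psd_sqrt Z_cov = (1 / sqrt 3) *\<^sub>R Z_cov"
proof -
  define A where "A = (1 / sqrt 3) *\<^sub>R Z_cov"
  have tA: "transpose A = A"
    by (simp add: A_def Z_cov_def transpose_def vec_eq_iff)
  have sq: "A ** A = Z_cov"
  proof -
    have "A ** A = (1 / sqrt 3) *\<^sub>R ((1 / sqrt 3) *\<^sub>R (Z_cov ** Z_cov))"
      by (simp only: A_def scalar_matrix_assoc matrix_scalar_ac)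
    then show ?thesis by (simp only: Z_cov_squared) simp
  qed
  have sym: "x \<bullet> (B *v y) = (B *v x) \<bullet> y" if "transpose B = B" for B :: "real^3^3" and x y
    using that by (metis dot_lmul_matrix vector_transpose_matrix)
  have AA: "A *v (A *v x) = sqrt 3 *\<^sub>R (A *v x)" for x
  proof -
    have "A *v (A *v x) = Z_cov *v x"
      by (simp add: matrix_vector_mul_assoc sq)
    also have "Z_cov = sqrt 3 *\<^sub>R A" by (simp add: A_def)
    finally show ?thesis by (simp add: scaleR_matrix_vector_assoc)
  qed
  have quad: "(A *v x) \<bullet> (A *v x) = sqrt 3 * (x \<bullet> (A *v x))" for x
    by (metis AA inner_scaleR_right sym[OF tA])
  have psd: "0 \<le> x \<bullet> (A *v x)" for x
    using quad[of x] inner_ge_zero[of "A *v x"]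
    by (metis real_sqrt_gt_0_iff zero_less_numeral zero_le_mult_iff not_less)
  have "psd_sqrt Z_cov = A"
    unfolding psd_sqrt_def
  proof (rule the_equality)
    show "transpose A = A \<and> (\<forall>x. 0 \<le> x \<bullet> (A *v x)) \<and> A ** A = Z_cov"
      using tA psd sq by auto
  next
    fix B :: "real^3^3"
    assume "transpose B = B \<and> (\<forall>x. 0 \<le> x \<bullet> (B *v x)) \<and> B ** B = Z_cov"
    then have tB: "transpose B = B" and psdB: "\<And>x. 0 \<le> x \<bullet> (B *v x)" and sqB: "B ** B = Z_cov"
      by auto
    have "Z_cov ** B = B ** Z_cov"
      by (metis sqB matrix_mul_assoc)
    then have comm: "A ** B = B ** A"
      by (simp add: A_def matrix_scalar_ac flip: scalar_matrix_assoc)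
    show "B = A"
    proof (rule matrix_eq[THEN iffD2], rule allI)
      fix x
      define y where "y = A *v x - B *v x"
      have "A *v y + B *v y = (A ** A) *v x - (A ** B) *v x + ((B ** A) *v x - (B ** B) *v x)"
        by (simp add: y_def matrix_vector_mult_diff_distrib matrix_vector_mul_assoc)
      then have sum0: "A *v y + B *v y = 0"
        by (simp add: comm sq sqB)
      then have "y \<bullet> (A *v y) + y \<bullet> (B *v y) = 0"
        by (metis inner_add_right inner_zero_right)
      then have "y \<bullet> (A *v y) = 0"
        using psd[of y] psdB[of y] by linarith
      then have Ay: "A *v y = 0" using quad[of y] by simp
      with sum0 have By: "B *v y = 0" by simp
      have "y \<bullet> y = (A *v y) \<bullet> x - (B *v y) \<bullet> x"
        by (metis y_def inner_diff_right sym[OF tA] sym[OF tB])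
      then have "y = 0" using Ay By by simp
      then show "B *v x = A *v x" by (simp add: y_def)
    qed
  qed
  then show ?thesis by (simp add: A_def)
qed

end

theory Submission
  imports Defs "HOL-Real_Asymp.Real_Asymp"
begin

text \<open>
  While all three moves are available, R plays uniformly, so every round changes the score by a
  uniform element of \<open>{-1, 0, 1}\<close>, whatever N does. At round \<open>T0 n\<close> the three moves
  have on average about \<open>n powr (2 / 3)\<close> uses left, which is far more than the fluctuations of order
  \<open>sqrt n\<close>; so up to an event of vanishing probability the greedy game before \<open>T0 n\<close> is the
  game in which R always plays uniformly (\<open>expect_greedy_uniform_diff\<close>, \<open>prob_spent_uniform\<close>).
  The characteristic functions of that game are exact powers, and the early score tends to \<open>W\<close>.

  For the late score, let \<open>lead j\<close> be the number of times R has used \<open>j\<close> minus the number of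
  times she has used \<open>j + 1\<close>. Against a non-stupid N, score plus \<open>lead j\<close> has a nonnegative
  drift, and the drift is \<open>0\<close> as long as \<open>j + 1\<close> is available (\<open>expect_gain\<close>). At the
  end all leads vanish, so the late score is at least \<open>lead j\<close> at time \<open>T0 n\<close> plus a sum of
  martingale differences, for each \<open>j\<close>. Equality holds when \<open>j + 1\<close> is the move that R plays
  in the very last round, because that move was available throughout (\<open>late_score_attained\<close>).
  Thus the late score is the maximum of the three leads at time \<open>T0 n\<close>, up to martingales over
  only about \<open>3 * n powr (2 / 3)\<close> rounds, which are of order \<open>n powr (1 / 3)\<close>. The three leads,
  divided by \<open>sqrt n\<close>, converge jointly to \<open>Z\<close>; this uses Levy's continuity theorem in
  several dimensions, which is derived from the one-dimensional theorem and the Weierstrass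
  approximation theorem (\<open>levy_continuity_euclidean\<close>).

  For the negative part, let N play \<open>0\<close> as long as all moves are available. As long as
  they are, the score equals \<open>- lead 1\<close>, so this holds at time \<open>T0 n\<close> with high
  probability, and the lower bound for the late score with \<open>j = 1\<close>
  shows that the total score is bounded below by a martingale term of order \<open>n powr (1 / 3)\<close>.
  Hence the probability that the normalized total score is at most \<open>- 1 / 2\<close> tends to
  \<open>0\<close>, whereas independence of the two terms, or convergence to the convolution, would keep it
  bounded away from \<open>0\<close>.
\<close>

section \<open>Levy's continuity theorem in Euclidean space\<close>

text \<open>Finite combinations of the waves \<open>\<lambda>x. iexp (\<theta> \<bullet> x)\<close>: the functions whose integrals are
  determined by the characteristic function.\<close>

inductive trig_poly :: "('a::euclidean_space \<Rightarrow> complex) \<Rightarrow> bool" where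
  wave: "trig_poly (\<lambda>x. c * iexp (\<theta> \<bullet> x))"
| add: "trig_poly f \<Longrightarrow> trig_poly g \<Longrightarrow> trig_poly (\<lambda>x. f x + g x)"

lemma trig_poly_const: "trig_poly (\<lambda>x. c)"
  using trig_poly.wave[of c 0] by simp

lemma trig_poly_sum:
  "finite A \<Longrightarrow> (\<And>a. a \<in> A \<Longrightarrow> trig_poly (f a)) \<Longrightarrow> trig_poly (\<lambda>x. \<Sum>a\<in>A. f a x)"
  by (induction A rule: finite_induct) (auto intro: trig_poly_const trig_poly.add)

lemma trig_poly_mult:
  assumes "trig_poly f" "trig_poly g"
  shows "trig_poly (\<lambda>x. f x * g x)"
  using assms
proof (induction f arbitrary: g rule: trig_poly.induct)
  case (wave c \<theta>)
  then show ?case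
  proof (induction g rule: trig_poly.induct)
    case (wave d \<eta>)
    have "(\<lambda>x. c * iexp (\<theta> \<bullet> x) * (d * iexp (\<eta> \<bullet> x))) = (\<lambda>x. (c * d) * iexp ((\<theta> + \<eta>) \<bullet> x))"
      by (simp add: fun_eq_iff inner_add_left exp_add algebra_simps)
    then show ?case by (simp only: trig_poly.wave)
  next
    case (add f g)
    then show ?case by (simp add: distrib_left trig_poly.add)
  qed
next
  case (add f1 f2)
  then show ?case by (simp add: distrib_right trig_poly.add)
qed

text \<open>The map \<open>sine_clamp m\<close> sends the whole space into the cube \<open>cbox (- One) One\<close>
  and is inverted by \<open>m * arcsin\<close> on the box where all coordinates have modulus at most \<open>m\<close>.
  So a polynomial in its coordinates is a trigonometric polynomial, yet can approximate any given
  continuous function on a large box.\<close>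

definition sine_clamp :: "real \<Rightarrow> 'a::euclidean_space \<Rightarrow> 'a" where
  "sine_clamp m x = (\<Sum>b\<in>Basis. sin (x \<bullet> b / m) *\<^sub>R b)"

lemma trig_poly_sin: "trig_poly (\<lambda>x. complex_of_real (sin (x \<bullet> b / m)))"
proof -
  have "complex_of_real (sin y) = (1 / (2 * \<i>)) * iexp y + (- 1 / (2 * \<i>)) * iexp (- y)" for y
    unfolding sin_of_real[symmetric] sin_exp_eq by (simp add: field_simps exp_minus)
  moreover have "(b /\<^sub>R m) \<bullet> x = x \<bullet> b / m" "(- b /\<^sub>R m) \<bullet> x = - (x \<bullet> b / m)" for x
    by (simp_all add: inner_commute divide_inverse mult.commute)
  ultimately have "(\<lambda>x. complex_of_real (sin (x \<bullet> b / m))) =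
     (\<lambda>x. (1 / (2 * \<i>)) * iexp ((b /\<^sub>R m) \<bullet> x) + (- 1 / (2 * \<i>)) * iexp ((- b /\<^sub>R m) \<bullet> x))"
    by metis
  then show ?thesis
    by (simp only: trig_poly.intros)
qed

lemma trig_poly_polynomial_sine_clamp:
  assumes "real_polynomial_function p"
  shows "trig_poly (\<lambda>x. complex_of_real (p (sine_clamp m x)))"
  using assms
proof (induction p rule: real_polynomial_function.induct)
  case (linear f)
  then interpret bounded_linear f .
  have "(\<lambda>x. complex_of_real (f (sine_clamp m x))) =
     (\<lambda>x. \<Sum>b\<in>Basis. of_real (f b) * complex_of_real (sin (x \<bullet> b / m)))"
    by (simp add: fun_eq_iff sine_clamp_def sum scaleR mult.commute)
  then show ?case
    by (auto intro!: trig_poly_sum trig_poly_mult trig_poly_const trig_poly_sin)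
qed (auto intro: trig_poly_const trig_poly.add trig_poly_mult)

lemma trig_poly_bounded: "trig_poly f \<Longrightarrow> \<exists>B. \<forall>x. norm (f x) \<le> B"
proof (induction rule: trig_poly.induct)
  case (wave c \<theta>)
  show ?case by (rule exI[of _ "norm c"]) (simp add: norm_mult)
next
  case (add f g)
  then obtain B C where "\<forall>x. norm (f x) \<le> B" "\<forall>x. norm (g x) \<le> C" by blast
  then have "\<forall>x. norm (f x + g x) \<le> B + C" by (meson norm_triangle_mono)
  then show ?case by blast
qed

lemma trig_poly_measurable: "trig_poly f \<Longrightarrow> f \<in> borel_measurable borel"
  by (induction rule: trig_poly.induct) auto

lemma trig_poly_integrable:
  assumes "trig_poly f" "prob_space M" "sets M = sets borel"
  shows "integrable M f"
proof -
  interpret prob_space M by fact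
  show ?thesis
    using trig_poly_bounded[OF assms(1)] trig_poly_measurable[OF assms(1)]
    by (auto intro!: integrable_const_bound simp: measurable_cong_sets[OF assms(3) refl])
qed

lemma trig_poly_integral_converges:
  assumes M: "\<And>n. prob_space (M n)" "\<And>n. sets (M n) = sets borel"
    and M': "prob_space M'" "sets M' = sets borel"
    and char: "\<And>\<theta>. (\<lambda>n. \<integral>x. iexp (\<theta> \<bullet> x) \<partial>M n) \<longlonglongrightarrow> (\<integral>x. iexp (\<theta> \<bullet> x) \<partial>M')"
    and "trig_poly f"
  shows "(\<lambda>n. \<integral>x. f x \<partial>M n) \<longlonglongrightarrow> (\<integral>x. f x \<partial>M')"
  using \<open>trig_poly f\<close>
proof (induction rule: trig_poly.induct)
  case (wave c \<theta>)
  then show ?case by (auto intro!: tendsto_mult char)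
next
  case (add f g)
  have "(\<integral>x. f x + g x \<partial>N) = (\<integral>x. f x \<partial>N) + (\<integral>x. g x \<partial>N)"
    if "prob_space N" "sets N = sets borel" for N
    using trig_poly_integrable[OF _ that] add.hyps by simp
  with M M' add.IH show ?case by (auto intro!: tendsto_add)
qed

text \<open>A continuous majorant of the indicator of \<open>\<bar>y\<bar> \<ge> K + 1\<close> that vanishes for
  \<open>\<bar>y\<bar> \<le> K\<close>. It measures tails by integrals of continuous functions, to which
  weak convergence of the one-dimensional projections applies directly.\<close>

definition ramp :: "real \<Rightarrow> real \<Rightarrow> real" where
  "ramp K y = min 1 (max 0 (\<bar>y\<bar> - K))"

lemma ramp_bounds: "0 \<le> ramp K y" "ramp K y \<le> 1" "\<bar>ramp K y\<bar> \<le> 1"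
  by (auto simp: ramp_def)

lemma ramp_continuous: "continuous_on S (ramp K)"
  unfolding ramp_def by (intro continuous_intros)

lemma ramp_measurable [measurable]: "ramp K \<in> borel_measurable borel"
  unfolding ramp_def by measurable

lemma ramp_tail_vanishes:
  assumes "prob_space M" and [measurable]: "g \<in> borel_measurable M"
  shows "(\<lambda>k. \<integral>x. ramp (real k) (g x) \<partial>M) \<longlonglongrightarrow> 0"
proof -
  interpret prob_space M by fact
  have "(\<lambda>k. \<integral>x. ramp (real k) (g x) \<partial>M) \<longlonglongrightarrow> (\<integral>x. 0 \<partial>M)"
  proof (rule integral_dominated_convergence[where w="\<lambda>_. 1"])
    show "AE x in M. (\<lambda>k. ramp (real k) (g x)) \<longlonglongrightarrow> 0"
    proof (rule AE_I2)
      fix x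
      have "\<forall>\<^sub>F k in sequentially. \<bar>g x\<bar> \<le> real k"
        by (rule eventually_sequentiallyI[of "nat \<lceil>\<bar>g x\<bar>\<rceil>"]) linarith
      then have "\<forall>\<^sub>F k in sequentially. ramp (real k) (g x) = 0"
        by eventually_elim (auto simp: ramp_def)
      then show "(\<lambda>k. ramp (real k) (g x)) \<longlonglongrightarrow> 0"
        by (rule tendsto_eventually)
    qed
  qed (use ramp_bounds in auto)
  then show ?thesis by simp
qed


lemma char_distr_inner:
  assumes "prob_space M" "sets M = sets (borel :: 'a::euclidean_space measure)"
  shows "char (distr M borel (\<lambda>x. b \<bullet> x)) t = (\<integral>x. iexp ((t *\<^sub>R b) \<bullet> x) \<partial>M)"
proof -
  have "(\<lambda>x. b \<bullet> x) \<in> M \<rightarrow>\<^sub>M borel"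
    by (simp add: measurable_cong_sets[OF assms(2) refl])
  then show ?thesis
    unfolding char_def by (subst integral_distr) auto
qed

text \<open>Tightness comes for free: the one-dimensional continuity theorem applied to the projections on
  the basis vectors controls the integrals of \<open>ramp\<close>. On a large box \<open>f\<close> is approximated
  uniformly by a trigonometric polynomial, obtained from the Weierstrass theorem applied to \<open>f\<close>
  in the sine coordinates; outside the box both functions are bounded, and the tails are small.\<close>

theorem levy_continuity_euclidean:
  fixes M :: "nat \<Rightarrow> 'a::euclidean_space measure" and f :: "'a \<Rightarrow> real"
  assumes M: "\<And>n. prob_space (M n)" "\<And>n. sets (M n) = sets borel"
    and M': "prob_space M'" "sets M' = sets borel"
    and char: "\<And>\<theta>. (\<lambda>n. \<integral>x. iexp (\<theta> \<bullet> x) \<partial>M n) \<longlonglongrightarrow> (\<integral>x. iexp (\<theta> \<bullet> x) \<partial>M')"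
    and f: "continuous_on UNIV f" and bound: "\<And>x. \<bar>f x\<bar> \<le> B"
  shows "(\<lambda>n. \<integral>x. f x \<partial>M n) \<longlonglongrightarrow> (\<integral>x. f x \<partial>M')"
proof -
  have meas: "measurable N R = measurable borel R" if "sets N = sets (borel :: 'a measure)" for N and R :: "'c measure"
    using measurable_cong_sets[OF that refl] .
  have ramp_lim: "(\<lambda>n. \<integral>x. ramp K (b \<bullet> x) \<partial>M n) \<longlonglongrightarrow> (\<integral>x. ramp K (b \<bullet> x) \<partial>M')" for K b
  proof -
    have rd: "real_distribution (distr N borel (\<lambda>x. b \<bullet> x))"
      if "prob_space N" "sets N = sets borel" for N
      using prob_space.prob_space_distr[OF that(1), of "\<lambda>x. b \<bullet> x" borel] that
      by (simp add: real_distribution_def real_distribution_axioms_def meas[OF that(2)])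
    have "weak_conv_m (\<lambda>n. distr (M n) borel (\<lambda>x. b \<bullet> x)) (distr M' borel (\<lambda>x. b \<bullet> x))"
      by (rule levy_continuity) (simp_all only: rd M M' char_distr_inner char)
    then have "(\<lambda>n. \<integral>y. ramp K y \<partial>distr (M n) borel (\<lambda>x. b \<bullet> x)) \<longlonglongrightarrow>
               (\<integral>y. ramp K y \<partial>distr M' borel (\<lambda>x. b \<bullet> x))"
      using ramp_continuous[of UNIV K] ramp_bounds[of K]
      by (intro weak_conv_imp_integral_bdd_continuous_conv[where B=1])
         (auto simp: rd M M' continuous_on_eq_continuous_at)
    then show ?thesis
      by (simp add: integral_distr meas[OF M(2)] meas[OF M'(2)])
  qed
  show ?thesis
  proof (rule LIMSEQ_I)
    fix e :: real assume "0 < e"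
    have B: "0 \<le> B" using bound[of 0] by simp
    \<comment> \<open>Five small terms: two uniform approximation errors, two tails, and the convergence of the
      integrals of the trigonometric polynomial.\<close>
    define d where "d = e / 5"
    have d: "0 < d" using \<open>0 < e\<close> by (simp add: d_def)
    have "(\<lambda>k. \<Sum>b\<in>Basis. \<integral>x. ramp (real k) (b \<bullet> x) \<partial>M') \<longlonglongrightarrow> (\<Sum>b\<in>(Basis::'a set). 0)"
      by (intro tendsto_sum ramp_tail_vanishes M') (simp add: meas[OF M'(2)])
    then have "(\<lambda>k. 2 * B * (\<Sum>b\<in>Basis. \<integral>x. ramp (real k) (b \<bullet> x) \<partial>M')) \<longlonglongrightarrow> 2 * B * 0"
      by (intro tendsto_mult tendsto_const) simp
    then have "\<forall>\<^sub>F k in sequentially. 2 * B * (\<Sum>b\<in>Basis. \<integral>x. ramp (real k) (b \<bullet> x) \<partial>M') < d"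
      using d by (simp add: order_tendsto_iff)
    then obtain k where k: "2 * B * (\<Sum>b\<in>Basis. \<integral>x. ramp (real k) (b \<bullet> x) \<partial>M') < d"
      by (auto simp: eventually_sequentially)
    \<comment> \<open>Off the box of size \<open>m = k + 1\<close> some \<open>ramp (real k)\<close> equals \<open>1\<close>.\<close>
    define m where "m = real k + 1"
    have m: "0 < m" by (simp add: m_def)
    define R where "R x = (\<Sum>b\<in>(Basis::'a set). ramp (real k) (b \<bullet> x))" for x
    define F where "F u = f (\<Sum>b\<in>Basis. (m * arcsin (u \<bullet> b)) *\<^sub>R b)" for u :: 'a
    have "continuous_on (cbox (- One) One) F"
      unfolding F_def
      by (rule continuous_on_compose2[OF f])
         (auto intro!: continuous_intros simp: mem_box inner_Basis inner_sum_left sum.If_cases)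
    then obtain p where p: "polynomial_function p" "\<forall>u\<in>cbox (- One) One. norm (F u - p u) < d"
      using Stone_Weierstrass_polynomial_function[OF compact_cbox _ d] by blast
    define h where "h x = p (sine_clamp m x)" for x
    have trig: "trig_poly (\<lambda>x. complex_of_real (h x))"
      unfolding h_def using p(1)
      by (intro trig_poly_polynomial_sine_clamp) (simp add: real_polynomial_function_eq)
    have approx: "\<bar>f x - h x\<bar> \<le> d + 2 * B * R x" for x
    proof -
      have sc: "sine_clamp m x \<bullet> b = sin (x \<bullet> b / m)" if "b \<in> Basis" for b
        using that by (simp add: sine_clamp_def inner_sum_left inner_Basis if_distrib cong: if_cong)
      then have "sine_clamp m x \<in> cbox (- One) One"
        by (simp add: mem_box inner_Basis)
      then have 1: "\<bar>F (sine_clamp m x) - h x\<bar> < d"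
        using p(2) by (simp add: h_def)
      show ?thesis
      proof (cases "\<forall>b\<in>Basis. \<bar>x \<bullet> b\<bar> \<le> m")
        case True
        have "m * arcsin (sine_clamp m x \<bullet> b) = x \<bullet> b" if b: "b \<in> Basis" for b
        proof -
          have "\<bar>x \<bullet> b / m\<bar> \<le> 1" using True b m by simp
          then have "- (pi / 2) \<le> x \<bullet> b / m" "x \<bullet> b / m \<le> pi / 2"
            using pi_ge_two by linarith+
          then have "arcsin (sin (x \<bullet> b / m)) = x \<bullet> b / m"
            by (rule arcsin_sin)
          then show ?thesis using m by (simp add: sc b)
        qed
        then have "F (sine_clamp m x) = f x"
          unfolding F_def by (simp add: euclidean_representation)
        moreover have "0 \<le> B * R x"
          using B by (auto simp: R_def intro!: mult_nonneg_nonneg sum_nonneg ramp_bounds)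
        ultimately show ?thesis using 1 by simp
      next
        case False
        then obtain b where b: "b \<in> Basis" "m < \<bar>x \<bullet> b\<bar>" by force
        have "1 = ramp (real k) (b \<bullet> x)" using b by (simp add: ramp_def m_def inner_commute)
        also have "\<dots> \<le> R x"
          unfolding R_def using b by (intro member_le_sum) (auto simp: ramp_bounds)
        finally have "2 * B * 1 \<le> 2 * B * R x"
          using B by (intro mult_left_mono) auto
        moreover have "\<bar>F (sine_clamp m x)\<bar> \<le> B" "\<bar>f x\<bar> \<le> B"
          using bound by (auto simp: F_def)
        ultimately show ?thesis using 1 by linarith
      qed
    qed
    have int_approx: "\<bar>(\<integral>x. f x \<partial>N) - (\<integral>x. h x \<partial>N)\<bar> \<le> d + 2 * B * (\<Sum>b\<in>Basis. \<integral>x. ramp (real k) (b \<bullet> x) \<partial>N)"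
      and int_h: "integrable N h"
      if N: "prob_space N" "sets N = sets borel" for N
    proof -
      interpret prob_space N by fact
      have ig: "integrable N f"
        using bound borel_measurable_continuous_onI[OF f]
        by (auto intro!: integrable_const_bound[where B=B] simp: meas[OF N(2)])
      have ih: "integrable N h"
        using trig_poly_integrable[OF trig N] by (simp add: complex_of_real_integrable_eq)
      then show "integrable N h" .
      have ir: "integrable N (\<lambda>x. ramp (real k) (b \<bullet> x))" for b
        using ramp_bounds by (auto intro!: integrable_const_bound[where B=1] simp: meas[OF N(2)])
      have "\<bar>(\<integral>x. f x \<partial>N) - (\<integral>x. h x \<partial>N)\<bar> = \<bar>\<integral>x. f x - h x \<partial>N\<bar>"
        using ig ih by simp
      also have "\<dots> \<le> (\<integral>x. \<bar>f x - h x\<bar> \<partial>N)"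
        by (rule integral_abs_bound)
      also have "\<dots> \<le> (\<integral>x. d + 2 * B * R x \<partial>N)"
        using approx ig ih ir unfolding R_def
        by (intro integral_mono) auto
      also have "\<dots> = d + 2 * B * (\<Sum>b\<in>Basis. \<integral>x. ramp (real k) (b \<bullet> x) \<partial>N)"
        using ir by (simp add: R_def prob_space)
      finally show "\<bar>(\<integral>x. f x \<partial>N) - (\<integral>x. h x \<partial>N)\<bar> \<le> d + 2 * B * (\<Sum>b\<in>Basis. \<integral>x. ramp (real k) (b \<bullet> x) \<partial>N)" .
    qed
    have "(\<lambda>n. complex_of_real (\<integral>x. h x \<partial>M n)) \<longlonglongrightarrow> complex_of_real (\<integral>x. h x \<partial>M')"
      using trig_poly_integral_converges[OF M M' char trig] by simp
    then have "(\<lambda>n. \<integral>x. h x \<partial>M n) \<longlonglongrightarrow> (\<integral>x. h x \<partial>M')"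
      by (simp add: tendsto_of_real_iff)
    then have "\<forall>\<^sub>F n in sequentially. dist (\<integral>x. h x \<partial>M n) (\<integral>x. h x \<partial>M') < d"
      using d by (rule tendstoD)
    moreover
    have "(\<lambda>n. 2 * B * (\<Sum>b\<in>Basis. \<integral>x. ramp (real k) (b \<bullet> x) \<partial>M n)) \<longlonglongrightarrow>
       2 * B * (\<Sum>b\<in>(Basis::'a set). \<integral>x. ramp (real k) (b \<bullet> x) \<partial>M')"
      by (intro tendsto_mult tendsto_const tendsto_sum ramp_lim)
    then have "\<forall>\<^sub>F n in sequentially. 2 * B * (\<Sum>b\<in>(Basis::'a set). \<integral>x. ramp (real k) (b \<bullet> x) \<partial>M n) < d"
      using k by (simp add: order_tendsto_iff)
    ultimately have "\<forall>\<^sub>F n in sequentially. norm ((\<integral>x. f x \<partial>M n) - (\<integral>x. f x \<partial>M')) < e"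
    proof eventually_elim
      case (elim n)
      then show ?case
        using int_approx[OF M, of n] int_approx[OF M'] k
        unfolding dist_real_def d_def real_norm_def by linarith
    qed
    then show "\<exists>no. \<forall>n\<ge>no. norm ((\<integral>x. f x \<partial>M n) - (\<integral>x. f x \<partial>M')) < e"
      by (simp add: eventually_sequentially)
  qed
qed

text \<open>Continuous mapping, in the form needed to apply the one-dimensional continuity theorem to the
  laws of \<open>g\<close>.\<close>

corollary char_distr_continuous_converges:
  fixes M :: "nat \<Rightarrow> 'a::euclidean_space measure" and g :: "'a \<Rightarrow> real"
  assumes M: "\<And>n. prob_space (M n)" "\<And>n. sets (M n) = sets borel"
    and M': "prob_space M'" "sets M' = sets borel"
    and char: "\<And>\<theta>. (\<lambda>n. \<integral>x. iexp (\<theta> \<bullet> x) \<partial>M n) \<longlonglongrightarrow> (\<integral>x. iexp (\<theta> \<bullet> x) \<partial>M')"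
    and g: "continuous_on UNIV g"
  shows "(\<lambda>n. \<integral>x. iexp (g x) \<partial>M n) \<longlonglongrightarrow> (\<integral>x. iexp (g x) \<partial>M')"
proof -
  have split: "(\<integral>x. iexp (g x) \<partial>N) = of_real (\<integral>x. cos (g x) \<partial>N) + \<i> * of_real (\<integral>x. sin (g x) \<partial>N)"
    if N: "prob_space N" "sets N = sets borel" for N
  proof -
    interpret prob_space N by fact
    have [measurable]: "g \<in> borel_measurable N"
      using borel_measurable_continuous_onI[OF g] by (simp add: measurable_cong_sets[OF N(2) refl])
    have i: "integrable N (\<lambda>x. cos (g x))" "integrable N (\<lambda>x. sin (g x))"
      by (auto intro!: integrable_const_bound[where B=1])
    have "(\<integral>x. iexp (g x) \<partial>N) = (\<integral>x. complex_of_real (cos (g x)) + \<i> * complex_of_real (sin (g x)) \<partial>N)"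
      by (simp add: exp_Euler cos_of_real sin_of_real)
    also have "\<dots> = of_real (\<integral>x. cos (g x) \<partial>N) + \<i> * of_real (\<integral>x. sin (g x) \<partial>N)"
      using i by simp
    finally show ?thesis .
  qed
  have "(\<lambda>n. \<integral>x. cos (g x) \<partial>M n) \<longlonglongrightarrow> (\<integral>x. cos (g x) \<partial>M')"
       "(\<lambda>n. \<integral>x. sin (g x) \<partial>M n) \<longlonglongrightarrow> (\<integral>x. sin (g x) \<partial>M')"
    using g by (auto intro!: levy_continuity_euclidean[OF M M' char, where B=1] continuous_intros)
  then show ?thesis
    unfolding split[OF M] split[OF M']
    by (intro tendsto_intros)
qed

section \<open>Expectations along a play\<close>

abbreviation expect :: "'a pmf \<Rightarrow> ('a \<Rightarrow> 'b::{banach, second_countable_topology}) \<Rightarrow> 'b" where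
  "expect p f \<equiv> measure_pmf.expectation p f"

lemma move_exhaust: "(i::move) = 0 \<or> i = 1 \<or> i = 2"
proof -
  have "(3::move) = 0" by simp
  then show ?thesis using exhaust_3[of i] by metis
qed

lemma UNIV_move: "(UNIV :: move set) = {0, 1, 2}"
proof -
  have "x \<in> {0, 1, 2}" for x :: move
    using move_exhaust[of x] by simp
  then show ?thesis by blast
qed

lemma sum_move: "(\<Sum>i\<in>(UNIV :: move set). f i) = f 0 + (f 1 + f 2)"
proof -
  have "(3::move) = 0" by simp
  then show ?thesis by (metis sum_3 add.commute add.assoc)
qed

lemma all_move: "(\<forall>i::move. P i) \<longleftrightarrow> P 0 \<and> P 1 \<and> P 2"
proof -
  have "(\<forall>i\<in>{0, 1, 2::move}. P i) \<longleftrightarrow> P 0 \<and> P 1 \<and> P 2" by simp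
  then show ?thesis unfolding UNIV_move[symmetric] by blast
qed

text \<open>The case distinction behind the definition of \<open>greedy\<close>: a two-element set of residues
  modulo 3 always consists of two cyclic neighbours.\<close>

lemma move_set_cases:
  fixes A :: "move set"
  obtains "A = {}" | i where "A = {i}" | i where "A = {i, i + 1}" | "A = UNIV"
proof -
  have "A = {} \<or> A = {0} \<or> A = {1} \<or> A = {2} \<or> A = {0, 0 + 1} \<or> A = {1, 1 + 1} \<or> A = {2, 2 + 1}
      \<or> A = UNIV"
    unfolding set_eq_iff all_move
    by (cases "0 \<in> A"; cases "1 \<in> A"; cases "2 \<in> A") simp_all
  then show ?thesis using that by blast
qed

lemma succ_neq_move [simp]: "i + 1 \<noteq> (i::move)" "i \<noteq> i + (1::move)"
  by simp_all

lemma two_moves_inject: "{i, i + 1} = {j, j + 1} \<longleftrightarrow> i = (j :: move)"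
proof -
  have "j + 1 + 1 \<noteq> j" by (simp add: add.assoc)
  then show ?thesis unfolding doubleton_eq_iff by metis
qed

lemma two_moves_not_all: "{i, i + 1} \<noteq> (UNIV :: move set)" "{i} \<noteq> (UNIV :: move set)"
proof -
  have "i + 2 \<notin> {i, i + 1}" by simp
  then show "{i, i + 1} \<noteq> UNIV" "{i} \<noteq> UNIV" by blast+
qed

text \<open>Conditioning on the move of N: in this game the conditional expectation is often the same for
  every move that N may make, and then his strategy is irrelevant.\<close>

lemma expect_pair_const:
  fixes p q :: "'a::finite pmf"
  assumes "\<And>s. s \<in> set_pmf q \<Longrightarrow> expect p (\<lambda>r. F (r, s)) = c"
  shows "expect (pair_pmf p q) F = c"
proof -
  have "expect (pair_pmf p q) F = (\<Sum>(r, s)\<in>UNIV \<times> UNIV. pmf (pair_pmf p q) (r, s) *\<^sub>R F (r, s))"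
    by (subst integral_measure_pmf[of UNIV]) (auto intro: sum.cong)
  also have "\<dots> = (\<Sum>r\<in>UNIV. \<Sum>s\<in>UNIV. pmf q s *\<^sub>R pmf p r *\<^sub>R F (r, s))"
    by (subst sum.cartesian_product[symmetric]) (simp add: pmf_pair mult.commute)
  also have "\<dots> = (\<Sum>s\<in>UNIV. pmf q s *\<^sub>R (\<Sum>r\<in>UNIV. pmf p r *\<^sub>R F (r, s)))"
    by (subst sum.swap) (simp add: scaleR_sum_right)
  also have "\<dots> = (\<Sum>s\<in>UNIV. pmf q s *\<^sub>R expect p (\<lambda>r. F (r, s)))"
    by (subst integral_measure_pmf[of UNIV]) auto
  also have "\<dots> = (\<Sum>s\<in>UNIV. pmf q s *\<^sub>R c)"
    by (intro sum.cong refl) (metis assms pmf_eq_0_set_pmf scaleR_zero_left)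
  also have "\<dots> = c"
    by (simp add: scaleR_sum_left[symmetric] sum_pmf_eq_1)
  finally show ?thesis .
qed

lemma play_length: "h \<in> set_pmf (play \<rho> \<sigma> t) \<Longrightarrow> length h = t"
  by (induction t arbitrary: h) auto

lemma finite_play: "finite (set_pmf (play \<rho> \<sigma> t))"
  by (induction t) auto

lemma integrable_play: "integrable (measure_pmf (play \<rho> \<sigma> t)) f"
  for f :: "history \<Rightarrow> 'b::{banach, second_countable_topology}"
  by (rule integrable_measure_pmf_finite[OF finite_play])

lemma expect_play_Suc:
  fixes f :: "history \<Rightarrow> 'b::{banach, second_countable_topology}"
  shows "expect (play \<rho> \<sigma> (Suc t)) f =
    expect (play \<rho> \<sigma> t) (\<lambda>h. expect (pair_pmf (\<rho> h) (\<sigma> h)) (\<lambda>m. f (h @ [m])))"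
proof -
  have "expect (play \<rho> \<sigma> (Suc t)) f = (\<Sum>h\<in>set_pmf (play \<rho> \<sigma> t).
      pmf (play \<rho> \<sigma> t) h *\<^sub>R expect (map_pmf (\<lambda>m. h @ [m]) (pair_pmf (\<rho> h) (\<sigma> h))) f)"
    unfolding play.simps by (subst pmf_expectation_bind[OF finite_play]) auto
  also have "\<dots> = expect (play \<rho> \<sigma> t) (\<lambda>h. expect (pair_pmf (\<rho> h) (\<sigma> h)) (\<lambda>m. f (h @ [m])))"
    by (subst integral_measure_pmf[OF finite_play]) auto
  finally show ?thesis .
qed

lemma expect_cong_pmf:
  "(\<And>h. h \<in> set_pmf p \<Longrightarrow> f h = g h) \<Longrightarrow> expect p f = expect p g"
  by (rule integral_cong_AE) (auto simp: AE_measure_pmf_iff)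

lemma take_play:
  assumes "s \<le> t"
  shows "map_pmf (take s) (play \<rho> \<sigma> t) = play \<rho> \<sigma> s"
  using assms
proof (induction t rule: dec_induct)
  case base
  show ?case
    by (simp add: map_pmf_idI play_length)
next
  case (step t)
  have "map_pmf (take s) (play \<rho> \<sigma> (Suc t)) = bind_pmf (play \<rho> \<sigma> t) (\<lambda>h. return_pmf (take s h))"
    unfolding play.simps map_bind_pmf using step.hyps
    by (intro bind_pmf_cong refl) (auto simp: pmf.map_comp o_def play_length map_pmf_const)
  then show ?case using step.IH by (simp add: map_pmf_def)
qed

lemma expect_take_play:
  fixes f :: "history \<Rightarrow> 'b::{banach, second_countable_topology}"
  assumes "s \<le> t"
  shows "expect (play \<rho> \<sigma> t) (\<lambda>h. f (take s h)) = expect (play \<rho> \<sigma> s) f"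
  by (simp flip: take_play[OF assms])

text \<open>Orthogonality of martingale differences: in each round the mixed term vanishes on conditioning,
  so the second moment grows by at most \<open>C\<^sup>2\<close>.\<close>

lemma martingale_second_moment:
  fixes g :: "history \<Rightarrow> move \<times> move \<Rightarrow> real"
  assumes "s \<le> t"
    and mean: "\<And>h. length h < t \<Longrightarrow> h \<in> set_pmf (play \<rho> \<sigma> (length h)) \<Longrightarrow> expect (pair_pmf (\<rho> h) (\<sigma> h)) (g h) = 0"
    and bound: "\<And>h m. \<bar>g h m\<bar> \<le> C"
  shows "expect (play \<rho> \<sigma> t) (\<lambda>h. (\<Sum>k=s..<t. g (take k h) (h ! k))\<^sup>2) \<le> C\<^sup>2 * (real t - real s)"
  using assms(1) mean
proof (induction t rule: dec_induct)
  case base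
  show ?case by simp
next
  case (step t)
  define X where "X h = (\<Sum>k=s..<t. g (take k h) (h ! k))" for h
  have int: "integrable (measure_pmf (pair_pmf (\<rho> h) (\<sigma> h))) f" for h and f :: "_ \<Rightarrow> real"
    by (rule integrable_measure_pmf_finite) simp
  have inner: "expect (pair_pmf (\<rho> h) (\<sigma> h)) (\<lambda>m. (\<Sum>k=s..<Suc t. g (take k (h @ [m])) ((h @ [m]) ! k))\<^sup>2)
      \<le> (X h)\<^sup>2 + C\<^sup>2" if h: "h \<in> set_pmf (play \<rho> \<sigma> t)" for h
  proof -
    have len: "length h = t" using play_length[OF h] .
    have "(\<Sum>k=s..<Suc t. g (take k (h @ [m])) ((h @ [m]) ! k)) = X h + g h m" for m
      using step.hyps len by (simp add: X_def nth_append)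
    then have "expect (pair_pmf (\<rho> h) (\<sigma> h)) (\<lambda>m. (\<Sum>k=s..<Suc t. g (take k (h @ [m])) ((h @ [m]) ! k))\<^sup>2)
        = expect (pair_pmf (\<rho> h) (\<sigma> h)) (\<lambda>m. (X h)\<^sup>2 + (2 * X h * g h m + (g h m)\<^sup>2))"
      by (simp add: power2_sum algebra_simps)
    also have "\<dots> = (X h)\<^sup>2 + (2 * X h * expect (pair_pmf (\<rho> h) (\<sigma> h)) (g h)
        + expect (pair_pmf (\<rho> h) (\<sigma> h)) (\<lambda>m. (g h m)\<^sup>2))"
      using int by simp
    also have "\<dots> = (X h)\<^sup>2 + expect (pair_pmf (\<rho> h) (\<sigma> h)) (\<lambda>m. (g h m)\<^sup>2)"
      using step.prems[of h] h len by simp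
    also have "expect (pair_pmf (\<rho> h) (\<sigma> h)) (\<lambda>m. (g h m)\<^sup>2) \<le> C\<^sup>2"
    proof (intro measure_pmf.integral_le_const int AE_I2)
      fix m
      show "(g h m)\<^sup>2 \<le> C\<^sup>2"
        using bound[of h m] by (simp add: abs_le_square_iff[symmetric])
    qed
    finally show ?thesis by simp
  qed
  have "expect (play \<rho> \<sigma> (Suc t)) (\<lambda>h. (\<Sum>k=s..<Suc t. g (take k h) (h ! k))\<^sup>2)
     \<le> expect (play \<rho> \<sigma> t) (\<lambda>h. (X h)\<^sup>2 + C\<^sup>2)"
    unfolding expect_play_Suc
    by (intro integral_mono_AE integrable_play) (simp only: AE_measure_pmf_iff, blast intro: inner)
  also have "\<dots> = expect (play \<rho> \<sigma> t) (\<lambda>h. (X h)\<^sup>2) + C\<^sup>2"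
    by (simp add: integrable_play)
  also have "expect (play \<rho> \<sigma> t) (\<lambda>h. (X h)\<^sup>2) \<le> C\<^sup>2 * (real t - real s)"
    unfolding X_def by (rule step.IH) (use step.prems in auto)
  finally show ?case by (simp add: algebra_simps)
qed

text \<open>If the conditional characteristic function of a round does not depend on the past, the
  characteristic function of the sum is a power, as for independent summands, even though the
  moves of N may depend on the history.\<close>

lemma expect_iexp_sum_list:
  fixes \<xi> :: "move \<times> move \<Rightarrow> real"
  assumes "\<And>h. expect (pair_pmf (\<rho> h) (\<sigma> h)) (\<lambda>m. iexp (\<xi> m)) = \<phi>"
  shows "expect (play \<rho> \<sigma> t) (\<lambda>h. iexp (\<Sum>m\<leftarrow>h. \<xi> m)) = \<phi> ^ t"
proof (induction t)
  case (Suc t)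
  have "expect (play \<rho> \<sigma> (Suc t)) (\<lambda>h. iexp (\<Sum>m\<leftarrow>h. \<xi> m)) =
    expect (play \<rho> \<sigma> t) (\<lambda>h. iexp (\<Sum>m\<leftarrow>h. \<xi> m) * \<phi>)"
    unfolding expect_play_Suc using assms
    by (simp add: exp_add distrib_left)
  then show ?case using Suc by simp
qed simp

definition uniform :: strategy where
  "uniform h = pmf_of_set UNIV"

abbreviation uses :: "history \<Rightarrow> move \<Rightarrow> nat" where
  "uses h i \<equiv> count_list (map fst h) i"

text \<open>The histories after which R still has all three moves.\<close>

definition unspent :: "nat \<Rightarrow> history set" where
  "unspent n = {h. \<forall>i. uses h i < n}"

lemma unspent_available: "h \<in> unspent n \<longleftrightarrow> available n h = UNIV"
  by (auto simp: unspent_def available_def)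

lemma unspent_prefix: "h @ h' \<in> unspent n \<Longrightarrow> h \<in> unspent n"
  unfolding unspent_def by (auto dest!: add_lessD1)

lemma greedy_unspent: "h \<in> unspent n \<Longrightarrow> greedy n h = uniform h"
  by (simp only: greedy_def unspent_available uniform_def Let_def) simp

text \<open>Availability is lost forever once it is lost, so a history in \<open>unspent n\<close> has only prefixes
  in \<open>unspent n\<close>, and along those both strategies of R agree. Hence the two games give the same
  weight to every such history.\<close>

lemma expect_greedy_eq_uniform:
  fixes f :: "history \<Rightarrow> 'b::{banach, second_countable_topology}"
  assumes "\<And>h. h \<notin> unspent n \<Longrightarrow> f h = 0"
  shows "expect (play (greedy n) \<sigma> t) f = expect (play uniform \<sigma> t) f"
  using assms
proof (induction t arbitrary: f)
  case (Suc t)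
  define F where "F h = expect (pair_pmf (uniform h) (\<sigma> h)) (\<lambda>m. f (h @ [m]))" for h
  have van: "f (h @ [m]) = 0" if "h \<notin> unspent n" for h m
    using that Suc.prems unspent_prefix by blast
  have "expect (play (greedy n) \<sigma> (Suc t)) f = expect (play (greedy n) \<sigma> t) F"
    unfolding expect_play_Suc
  proof (rule Bochner_Integration.integral_cong[OF refl])
    fix h
    show "expect (pair_pmf (greedy n h) (\<sigma> h)) (\<lambda>m. f (h @ [m])) = F h"
      by (cases "h \<in> unspent n") (simp_all add: F_def greedy_unspent van)
  qed
  also have "\<dots> = expect (play uniform \<sigma> t) F"
    by (rule Suc.IH) (simp add: F_def van)
  also have "\<dots> = expect (play uniform \<sigma> (Suc t)) f"
    unfolding expect_play_Suc F_def ..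
  finally show ?case .
qed simp

lemma prob_spent_greedy_eq_uniform:
  "measure_pmf.prob (play (greedy n) \<sigma> t) (- unspent n) = measure_pmf.prob (play uniform \<sigma> t) (- unspent n)"
proof -
  have "measure_pmf.prob (play (greedy n) \<sigma> t) (unspent n) = measure_pmf.prob (play uniform \<sigma> t) (unspent n)"
    using expect_greedy_eq_uniform[of n "indicat_real (unspent n)" \<sigma> t] by simp
  moreover have "measure_pmf.prob p (- unspent n) = 1 - measure_pmf.prob p (unspent n)" for p
    using measure_pmf.prob_compl[of "unspent n" p] by (simp add: Compl_eq_Diff_UNIV)
  ultimately show ?thesis by simp
qed

lemma expect_greedy_uniform_diff:
  fixes f :: "history \<Rightarrow> complex"
  assumes "\<And>h. norm (f h) \<le> 1"
  shows "norm (expect (play (greedy n) \<sigma> t) f - expect (play uniform \<sigma> t) f)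
    \<le> 2 * measure_pmf.prob (play uniform \<sigma> t) (- unspent n)"
proof -
  \<comment> \<open>On \<open>unspent n\<close> the two expectations agree; only the complement contributes.\<close>
  define f1 where "f1 h = indicat_real (unspent n) h *\<^sub>R f h" for h
  define f2 where "f2 h = indicat_real (- unspent n) h *\<^sub>R f h" for h
  have split: "expect (play \<rho> \<sigma> t) f = expect (play \<rho> \<sigma> t) f1 + expect (play \<rho> \<sigma> t) f2" for \<rho>
  proof -
    have "f = (\<lambda>h. f1 h + f2 h)"
      by (auto simp: f1_def f2_def indicator_def)
    then show ?thesis
      by (simp add: Bochner_Integration.integral_add[OF integrable_play integrable_play])
  qed
  have small: "norm (expect (play \<rho> \<sigma> t) f2) \<le> measure_pmf.prob (play \<rho> \<sigma> t) (- unspent n)" for \<rho>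
  proof -
    have "norm (expect (play \<rho> \<sigma> t) f2) \<le> expect (play \<rho> \<sigma> t) (\<lambda>h. norm (f2 h))"
      by (rule integral_norm_bound)
    also have "\<dots> \<le> expect (play \<rho> \<sigma> t) (indicat_real (- unspent n))"
      by (intro integral_mono integrable_play) (auto simp: f2_def assms indicator_def)
    finally show ?thesis by simp
  qed
  have "expect (play (greedy n) \<sigma> t) f1 = expect (play uniform \<sigma> t) f1"
    by (rule expect_greedy_eq_uniform) (simp add: f1_def)
  then have "norm (expect (play (greedy n) \<sigma> t) f - expect (play uniform \<sigma> t) f)
     = norm (expect (play (greedy n) \<sigma> t) f2 - expect (play uniform \<sigma> t) f2)"
    by (simp add: split)
  also have "\<dots> \<le> measure_pmf.prob (play (greedy n) \<sigma> t) (- unspent n) + measure_pmf.prob (play uniform \<sigma> t) (- unspent n)"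
    by (rule order_trans[OF norm_triangle_ineq4 add_mono[OF small small]])
  finally show ?thesis by (simp add: prob_spent_greedy_eq_uniform)
qed

section \<open>The drift of score plus lead\<close>

lemma greedy_two:
  assumes "available n h = {i, i + 1}"
  shows "greedy n h = map_pmf (\<lambda>b. if b then i else i + 1) (bernoulli_pmf (1 / 3))"
proof -
  have "card {i, i + 1} = 2" by (simp add: card_insert_if)
  moreover have "(THE j. {i, i + 1} = {j, j + 1}) = i"
    unfolding two_moves_inject by blast
  ultimately show ?thesis
    unfolding greedy_def Let_def assms by (simp only: simp_thms if_True)
qed

lemma greedy_one: "available n h = {i} \<Longrightarrow> greedy n h = return_pmf i"
  by (simp add: greedy_def pmf_of_set_singleton)

lemma set_greedy:
  assumes "available n h \<noteq> {}"
  shows "set_pmf (greedy n h) \<subseteq> available n h"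
proof (cases "available n h" rule: move_set_cases)
  case (3 i)
  then show ?thesis by (simp only: greedy_two[OF 3]) auto
qed (use assms greedy_one in auto)

lemma expect_greedy_two:
  fixes f :: "move \<Rightarrow> real"
  assumes "available n h = {i, i + 1}"
  shows "expect (greedy n h) f = f i / 3 + 2 * f (i + 1) / 3"
  by (simp add: greedy_two[OF assms])

lemma expect_uniform:
  fixes f :: "move \<Rightarrow> 'b::{banach, second_countable_topology}"
  shows "expect (uniform h) f = (1 / 3) *\<^sub>R (f 0 + (f 1 + f 2))"
  unfolding uniform_def
  by (subst integral_measure_pmf[of UNIV]) (simp_all add: sum_move scaleR_add_right)

lemma uses_simps: "uses [] i = 0" "uses (h @ [m]) i = uses h i + (if fst m = i then 1 else 0)"
  by auto

lemma sum_uses: "(\<Sum>i\<in>UNIV. uses h i) = length h"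
proof (induction h rule: rev_induct)
  case (snoc m h)
  then show ?case by (simp only: uses_simps sum.distrib) simp
qed simp

lemma available_nonempty:
  assumes "length h < 3 * n"
  shows "available n h \<noteq> {}"
proof
  assume "available n h = {}"
  then have "i \<notin> available n h" for i by simp
  then have "n \<le> uses h i" for i by (simp add: available_def not_less)
  then have "(\<Sum>i\<in>(UNIV::move set). n) \<le> (\<Sum>i\<in>UNIV. uses h i)" by (rule sum_mono)
  then have "(\<Sum>i\<in>(UNIV::move set). n) \<le> length h" by (simp only: sum_uses)
  then show False using assms by simp
qed

lemma play_greedy_legal:
  "t \<le> 3 * n \<Longrightarrow> h \<in> set_pmf (play (greedy n) \<sigma> t) \<Longrightarrow> legal_history n h"
proof (induction t arbitrary: h)
  case 0
  then show ?case by (simp add: legal_history_def)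
next
  case (Suc t)
  then obtain h' r s where h: "h = h' @ [(r, s)]" "h' \<in> set_pmf (play (greedy n) \<sigma> t)"
    "r \<in> set_pmf (greedy n h')" by auto
  have "length h' = t" using h play_length by blast
  then have "r \<in> available n h'"
    using set_greedy[OF available_nonempty] h Suc.prems by force
  moreover have "legal_history n h'" using Suc h by simp
  ultimately show ?case
    unfolding legal_history_def h(1) uses_simps by (auto simp: available_def)
qed

text \<open>The change of score plus \<open>lead j\<close> (defined below) in one round.\<close>

definition gain :: "move \<Rightarrow> move \<times> move \<Rightarrow> real" where
  "gain j m = of_int (round_score m) + (if fst m = j then 1 else 0) - (if fst m = j + 1 then 1 else 0)"

text \<open>The conditional mean of \<open>gain j\<close> when \<open>A\<close> is the set of moves available to R. What
  matters later is that it is nonnegative, and zero if \<open>j + 1\<close> is available.\<close>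

definition drift :: "move \<Rightarrow> move set \<Rightarrow> real" where
  "drift j A = (if j + 1 \<in> A then 0 else if j + 2 \<in> A then 1 else 2)"

text \<open>With three moves available everything is centred. With \<open>i\<close> and \<open>i + 1\<close> available, the
  probabilities \<open>1 / 3\<close> and \<open>2 / 3\<close> make the expected score \<open>1 / 3\<close> for both replies of a
  non-stupid N, which balances the mean decrease of \<open>lead i\<close> and of \<open>lead (i - 1)\<close>. With
  one move \<open>i\<close> available N wins every round, which balances the decrease of
  \<open>lead (i - 1)\<close>.\<close>

lemma expect_gain:
  assumes \<sigma>: "non_stupid n \<sigma>" and h: "length h < 3 * n" "legal_history n h"
  shows "expect (pair_pmf (greedy n h) (\<sigma> h)) (gain j) = drift j (available n h)"
proof (rule expect_pair_const)
  fix s assume s: "s \<in> set_pmf (\<sigma> h)"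
  show "expect (greedy n h) (\<lambda>r. gain j (r, s)) = drift j (available n h)"
  proof (cases "available n h" rule: move_set_cases)
    case 1
    then show ?thesis using available_nonempty[OF h(1)] by simp
  next
    case (2 i)
    then have "set_pmf (\<sigma> h) \<subseteq> {i + 1}" using \<sigma> h unfolding non_stupid_def by blast
    then have "s = i + 1" using s by blast
    then show ?thesis
      unfolding 2 greedy_one[OF 2]
      using move_exhaust[of i] move_exhaust[of j]
      by (elim disjE) (simp_all add: gain_def drift_def round_score_def)
  next
    case (3 i)
    then have "set_pmf (\<sigma> h) \<subseteq> {i + 1, i + 2}" using \<sigma> h unfolding non_stupid_def by blast
    then have "s = i + 1 \<or> s = i + 2" using s by blast
    then show ?thesis
      unfolding expect_greedy_two[OF 3] unfolding 3
      using move_exhaust[of i] move_exhaust[of j]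
      by (elim disjE) (simp_all add: gain_def drift_def round_score_def)
  next
    case 4
    then have "greedy n h = uniform h" by (simp add: greedy_unspent unspent_available)
    then show ?thesis
      using move_exhaust[of s] move_exhaust[of j] unfolding 4
      by (elim disjE) (simp_all add: expect_uniform gain_def drift_def round_score_def)
  qed
qed

text \<open>Equivalently, the number of uses that R has left of \<open>j + 1\<close> minus those left of \<open>j\<close>.\<close>

definition lead :: "move \<Rightarrow> history \<Rightarrow> real" where
  "lead j h = real (uses h j) - real (uses h (j + 1))"

lemma sum_gain:
  "(\<Sum>m\<leftarrow>h. gain j m) = of_int (score h (length h)) + lead j h"
proof (induction h rule: rev_induct)
  case (snoc m h)
  then show ?case by (simp add: score_def lead_def gain_def)
qed (simp add: score_def lead_def)

text \<open>Telescoping: score plus \<open>lead j\<close> is the sum of the gains.\<close>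

lemma sum_gain_late:
  assumes "s \<le> length h"
  shows "(\<Sum>k=s..<length h. gain j (h ! k)) =
    of_int (score h (length h) - score h s) + (lead j h - lead j (take s h))"
proof -
  have nth: "(\<Sum>m\<leftarrow>xs. gain j m) = (\<Sum>k=0..<length xs. gain j (xs ! k))" for xs
    by (simp add: sum_list_sum_nth)
  have "(\<Sum>k=0..<length h. gain j (h ! k)) = (\<Sum>k=0..<s. gain j (h ! k)) + (\<Sum>k=s..<length h. gain j (h ! k))"
    using assms by (simp add: sum.atLeastLessThan_concat)
  also have "(\<Sum>k=0..<s. gain j (h ! k)) = (\<Sum>m\<leftarrow>take s h. gain j m)"
    using assms by (simp add: nth)
  finally show ?thesis
    using assms by (simp add: nth[symmetric] sum_gain score_def)
qed

text \<open>The martingale difference in the Doob decomposition of score plus \<open>lead j\<close>.\<close>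

definition excess :: "nat \<Rightarrow> move \<Rightarrow> history \<Rightarrow> move \<times> move \<Rightarrow> real" where
  "excess n j h m = gain j m - drift j (available n h)"

definition late_noise :: "nat \<Rightarrow> nat \<Rightarrow> move \<Rightarrow> history \<Rightarrow> real" where
  "late_noise n s j h = (\<Sum>k=s..<3 * n. excess n j (take k h) (h ! k))"

lemma late_noise_second_moment:
  assumes "non_stupid n \<sigma>" "s \<le> 3 * n"
  shows "expect (play (greedy n) \<sigma> (3 * n)) (\<lambda>h. (late_noise n s j h)\<^sup>2) \<le> 16 * (3 * real n - real s)"
proof -
  have "\<bar>excess n j h m\<bar> \<le> 4" for h m
    by (cases m) (auto simp: excess_def gain_def drift_def round_score_def)
  moreover have "expect (pair_pmf (greedy n h) (\<sigma> h)) (excess n j h) = 0"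
    if "length h < 3 * n" "h \<in> set_pmf (play (greedy n) \<sigma> (length h))" for h
  proof -
    have int: "integrable (measure_pmf (pair_pmf (greedy n h) (\<sigma> h))) (gain j)"
      by (rule integrable_measure_pmf_finite) simp
    have "legal_history n h" using that play_greedy_legal[of "length h"] by simp
    then show ?thesis
      unfolding excess_def using expect_gain[OF assms(1) that(1), of j] int by simp
  qed
  ultimately show ?thesis
    unfolding late_noise_def using martingale_second_moment[OF assms(2), of "greedy n" \<sigma> "excess n j" 4]
    by simp
qed

text \<open>All leads vanish at the end of the game, since R has then used each move exactly \<open>n\<close>
  times.\<close>

lemma late_score_decomposition:
  assumes "h \<in> set_pmf (play (greedy n) \<sigma> (3 * n))" "s \<le> 3 * n"
  shows "of_int (score h (3 * n) - score h s) =
    lead j (take s h) + late_noise n s j h + (\<Sum>k=s..<3 * n. drift j (available n (take k h)))"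
proof -
  have len: "length h = 3 * n" using assms play_length by blast
  have le: "uses h i \<le> n" for i
    using play_greedy_legal[OF order_refl assms(1)] by (simp add: legal_history_def)
  have "uses h i = n" for i
  proof (rule ccontr)
    assume "uses h i \<noteq> n"
    then have "(\<Sum>i\<in>UNIV. uses h i) < (\<Sum>i\<in>(UNIV::move set). n)"
      using le by (intro sum_strict_mono_ex1) (auto simp: order_less_le)
    then have "length h < (\<Sum>i\<in>(UNIV::move set). n)" by (simp only: sum_uses)
    then show False by (simp add: len)
  qed
  then have "lead j h = 0" by (simp add: lead_def)
  then show ?thesis
    using sum_gain_late[of s h j] assms len
    by (simp add: late_noise_def excess_def sum_subtractf)
qed

lemma late_score_lower:
  assumes "h \<in> set_pmf (play (greedy n) \<sigma> (3 * n))" "s \<le> 3 * n"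
  shows "lead j (take s h) + late_noise n s j h \<le> of_int (score h (3 * n) - score h s)"
proof -
  have "0 \<le> (\<Sum>k=s..<3 * n. drift j (available n (take k h)))"
    by (intro sum_nonneg) (simp add: drift_def)
  then show ?thesis using late_score_decomposition[OF assms, of j] by simp
qed

text \<open>Let \<open>i\<close> be the move of R in the last round. It is available in every round, so for
  \<open>j = i - 1\<close> no drift ever accumulates. This identifies the right index without any discussion
  of the order in which the moves run out.\<close>

lemma late_score_attained:
  assumes h: "h \<in> set_pmf (play (greedy n) \<sigma> (3 * n))" "s \<le> 3 * n" and "0 < n"
  shows "\<exists>j. of_int (score h (3 * n) - score h s) = lead j (take s h) + late_noise n s j h"
proof -
  have len: "length h = 3 * n" using h play_length by blast
  define i where "i = fst (last h)"
  have "drift (i - 1) (available n (take k h)) = 0" if "k < 3 * n" for k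
  proof -
    have "h \<noteq> []" using len \<open>0 < n\<close> by auto
    then have "h = butlast h @ [last h]" by simp
    then have "take k h = take k (butlast h)"
      using that len by (metis Suc_leI butlast_conv_take diff_Suc_1 diff_le_mono min_absorb1 take_take)
    moreover have "uses (butlast h) i < n"
    proof -
      have "uses (butlast h @ [last h]) i \<le> n"
        using play_greedy_legal[OF order_refl h(1)] \<open>h \<noteq> []\<close> by (simp add: legal_history_def)
      then show ?thesis by (simp add: i_def)
    qed
    moreover have "uses (take k (butlast h)) i \<le> uses (butlast h) i"
      by (metis append_take_drop_id count_list_append le_add1 map_append)
    ultimately have "i \<in> available n (take k h)" by (simp add: available_def)
    then show ?thesis by (simp add: drift_def)
  qed
  then have "(\<Sum>k=s..<3 * n. drift (i - 1) (available n (take k h))) = 0" by simp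
  then show ?thesis using late_score_decomposition[OF h, of "i - 1"] by (intro exI[of _ "i - 1"]) linarith
qed

definition top_lead :: "history \<Rightarrow> real" where
  "top_lead h = Max (range (\<lambda>j. lead j h))"

lemma late_score_near_top_lead:
  assumes h: "h \<in> set_pmf (play (greedy n) \<sigma> (3 * n))" "s \<le> 3 * n" and "0 < n"
  shows "\<bar>of_int (score h (3 * n) - score h s) - top_lead (take s h)\<bar> \<le> (\<Sum>j\<in>UNIV. \<bar>late_noise n s j h\<bar>)"
proof -
  have noise: "\<bar>late_noise n s j h\<bar> \<le> (\<Sum>j\<in>UNIV. \<bar>late_noise n s j h\<bar>)" for j
    by (rule member_le_sum) auto
  have "top_lead (take s h) \<in> range (\<lambda>j. lead j (take s h))"
    unfolding top_lead_def by (rule Max_in) auto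
  then obtain j where j: "top_lead (take s h) = lead j (take s h)" by blast
  obtain i where i: "of_int (score h (3 * n) - score h s) = lead i (take s h) + late_noise n s i h"
    using late_score_attained[OF assms] by blast
  have "lead i (take s h) \<le> top_lead (take s h)"
    unfolding top_lead_def by (rule Max_ge) auto
  then show ?thesis
    using late_score_lower[OF h, of j] i j noise[of i] noise[of j] by linarith
qed

text \<open>The variance of \<open>\<bar>X\<bar>\<close> is nonnegative.\<close>

lemma expect_abs_le:
  fixes X :: "history \<Rightarrow> real"
  assumes "expect (play \<rho> \<sigma> t) (\<lambda>h. (X h)\<^sup>2) \<le> B"
  shows "expect (play \<rho> \<sigma> t) (\<lambda>h. \<bar>X h\<bar>) \<le> sqrt B"
proof (rule real_le_rsqrt)
  have "0 \<le> measure_pmf.variance (play \<rho> \<sigma> t) (\<lambda>h. \<bar>X h\<bar>)"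
    by (rule measure_pmf.variance_positive)
  then show "(expect (play \<rho> \<sigma> t) (\<lambda>h. \<bar>X h\<bar>))\<^sup>2 \<le> B"
    using assms by (simp add: measure_pmf.variance_eq integrable_play)
qed

lemma expect_late_error:
  assumes "non_stupid n \<sigma>" "s \<le> 3 * n" "0 < n"
  shows "expect (play (greedy n) \<sigma> (3 * n))
      (\<lambda>h. \<bar>of_int (score h (3 * n) - score h s) - top_lead (take s h)\<bar>) \<le> 12 * sqrt (3 * real n - real s)"
proof -
  have "expect (play (greedy n) \<sigma> (3 * n))
      (\<lambda>h. \<bar>of_int (score h (3 * n) - score h s) - top_lead (take s h)\<bar>)
    \<le> expect (play (greedy n) \<sigma> (3 * n)) (\<lambda>h. \<Sum>j\<in>UNIV. \<bar>late_noise n s j h\<bar>)"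
    using late_score_near_top_lead assms
    by (intro integral_mono_AE integrable_play) (auto simp: AE_measure_pmf_iff)
  also have "\<dots> = (\<Sum>j\<in>UNIV. expect (play (greedy n) \<sigma> (3 * n)) (\<lambda>h. \<bar>late_noise n s j h\<bar>))"
    by (rule Bochner_Integration.integral_sum) (rule integrable_play)
  also have "\<dots> \<le> (\<Sum>j\<in>(UNIV::move set). sqrt (16 * (3 * real n - real s)))"
    using late_noise_second_moment[OF assms(1,2)] by (intro sum_mono expect_abs_le)
  also have "\<dots> = 12 * sqrt (3 * real n - real s)"
    unfolding real_sqrt_mult by simp
  finally show ?thesis .
qed

text \<open>Chebyshev's inequality for each of the three counts, whose centred increments are martingale
  differences bounded by \<open>1\<close>.\<close>

lemma prob_spent_uniform:
  assumes "t < 3 * n"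
  shows "measure_pmf.prob (play uniform \<sigma> t) (- unspent n) \<le> 3 * real t / (real n - real t / 3)\<^sup>2"
proof -
  define d where "d = real n - real t / 3"
  have d: "0 < d" using assms by (simp add: d_def)
  define g :: "move \<Rightarrow> history \<Rightarrow> move \<times> move \<Rightarrow> real"
    where "g i h m = (if fst m = i then 1 else 0) - 1 / 3" for i :: move and h :: history and m :: "move \<times> move"
  have sum_g: "(\<Sum>k=0..<t. g i (take k h) (h ! k)) = real (uses h i) - real t / 3" if "length h = t" for i h
    using that
  proof (induction h arbitrary: t rule: rev_induct)
    case (snoc m h)
    have "(\<Sum>k=0..<length h. g i (take k (h @ [m])) ((h @ [m]) ! k)) = (\<Sum>k=0..<length h. g i (take k h) (h ! k))"
      by (intro sum.cong) (auto simp: nth_append g_def)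
    with snoc show ?case by (auto simp: g_def field_simps)
  qed simp
  have second: "expect (play uniform \<sigma> t) (\<lambda>h. (real (uses h i) - real t / 3)\<^sup>2) \<le> real t" for i
  proof -
    have "expect (play uniform \<sigma> t) (\<lambda>h. (\<Sum>k=0..<t. g i (take k h) (h ! k))\<^sup>2) \<le> 1\<^sup>2 * (real t - real 0)"
    proof (rule martingale_second_moment)
      fix h
      show "expect (pair_pmf (uniform h) (\<sigma> h)) (g i h) = 0"
        by (rule expect_pair_const)
           (use move_exhaust[of i] in \<open>elim disjE; simp add: expect_uniform g_def\<close>)
    qed (auto simp: g_def)
    also have "expect (play uniform \<sigma> t) (\<lambda>h. (\<Sum>k=0..<t. g i (take k h) (h ! k))\<^sup>2) =
       expect (play uniform \<sigma> t) (\<lambda>h. (real (uses h i) - real t / 3)\<^sup>2)"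
      by (rule expect_cong_pmf) (simp add: sum_g play_length)
    finally show ?thesis by simp
  qed
  have "measure_pmf.prob (play uniform \<sigma> t) (- unspent n) = expect (play uniform \<sigma> t) (indicat_real (- unspent n))"
    by simp
  also have "\<dots> \<le> expect (play uniform \<sigma> t) (\<lambda>h. \<Sum>i\<in>UNIV. (real (uses h i) - real t / 3)\<^sup>2 / d\<^sup>2)"
  proof (intro integral_mono integrable_play)
    fix h
    have "1 \<le> (\<Sum>i\<in>UNIV. (real (uses h i) - real t / 3)\<^sup>2 / d\<^sup>2)" if spent: "h \<notin> unspent n"
    proof -
      obtain i where "n \<le> uses h i" using spent by (auto simp: unspent_def not_less)
      then have "d\<^sup>2 \<le> (real (uses h i) - real t / 3)\<^sup>2"
        using d by (intro power_mono) (auto simp: d_def)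
      then have "1 \<le> (real (uses h i) - real t / 3)\<^sup>2 / d\<^sup>2"
        using d by simp
      also have "\<dots> \<le> (\<Sum>i\<in>UNIV. (real (uses h i) - real t / 3)\<^sup>2 / d\<^sup>2)"
        by (rule member_le_sum) auto
      finally show ?thesis .
    qed
    then show "indicat_real (- unspent n) h \<le> (\<Sum>i\<in>UNIV. (real (uses h i) - real t / 3)\<^sup>2 / d\<^sup>2)"
      by (auto simp: indicator_def sum_nonneg)
  qed
  also have "\<dots> = (\<Sum>i\<in>UNIV. expect (play uniform \<sigma> t) (\<lambda>h. (real (uses h i) - real t / 3)\<^sup>2) / d\<^sup>2)"
    by (subst Bochner_Integration.integral_sum) (auto intro: integrable_play)
  also have "\<dots> \<le> (\<Sum>i\<in>(UNIV::move set). real t / d\<^sup>2)"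
    by (intro sum_mono divide_right_mono second) simp
  finally show ?thesis by (simp add: sum_move d_def)
qed

section \<open>The early score\<close>

lemma real_T0:
  assumes "1 \<le> n"
  shows "real (T0 n) = 3 * (real n - real (nat \<lceil>real n powr (2/3)\<rceil>))"
    and "0 < nat \<lceil>real n powr (2/3)\<rceil>"
proof -
  have "real n powr (2/3) \<le> real n powr 1"
    using assms by (intro powr_mono) auto
  then have "nat \<lceil>real n powr (2/3)\<rceil> \<le> n"
    by (simp add: nat_le_iff ceiling_le_iff)
  then show "real (T0 n) = 3 * (real n - real (nat \<lceil>real n powr (2/3)\<rceil>))"
    by (simp add: T0_def of_nat_diff)
  show "0 < nat \<lceil>real n powr (2/3)\<rceil>"
    using assms by simp
qed

lemma T0_le: "T0 n \<le> 3 * n"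
  by (simp add: T0_def)

lemma iexp_quadratic_approx: "norm (iexp y - complex_of_real (1 - y\<^sup>2 / 2) - \<i> * of_real y) \<le> \<bar>y\<bar> ^ 3 / 6"
proof -
  have "(\<Sum>k\<le>2. (\<i> * complex_of_real y) ^ k / fact k) = complex_of_real (1 - y\<^sup>2 / 2) + \<i> * of_real y"
    by (simp add: numeral_2_eq_2 power2_eq_square algebra_simps)
  moreover have "\<bar>y\<bar> ^ Suc 2 / fact (Suc 2) = \<bar>y\<bar> ^ 3 / 6"
    by (simp add: eval_nat_numeral)
  ultimately show ?thesis
    using iexp_approx1[of y 2] unfolding diff_diff_eq by metis
qed

text \<open>The central limit theorem for a centred uniform choice among three values, with \<open>T0 n\<close>
  summands: compare with the powers of \<open>1 - q / (6 * n)\<close>, where \<open>q / 3\<close> is the variance of one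
  summand, and use that \<open>T0 n\<close> is asymptotically \<open>3 * n\<close>. Both the score and the linear
  combinations of the leads reduce to it.\<close>

lemma three_point_char_limit:
  fixes u :: "move \<Rightarrow> real"
  assumes centred: "(\<Sum>i\<in>UNIV. u i) = 0"
  shows "(\<lambda>n. ((1 / 3) * (\<Sum>i\<in>UNIV. iexp (u i / sqrt (real n)))) ^ T0 n)
    \<longlonglongrightarrow> complex_of_real (exp (- (\<Sum>i\<in>UNIV. (u i)\<^sup>2) / 2))"
proof -
  define q where "q = (\<Sum>i\<in>UNIV. (u i)\<^sup>2)"
  define K where "K = (\<Sum>i\<in>UNIV. \<bar>u i\<bar> ^ 3) / 18"
  define z where "z n = (1 / 3) * (\<Sum>i\<in>UNIV. iexp (u i / sqrt (real n)))" for n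
  define w where "w n = 1 - q / (6 * real n)" for n
  have q: "0 \<le> q" by (auto simp: q_def intro: sum_nonneg)
  have z1: "norm (z n) \<le> 1" for n
  proof -
    have "norm (\<Sum>i\<in>UNIV. iexp (u i / sqrt (real n))) \<le> (\<Sum>i\<in>(UNIV::move set). 1)"
      by (intro sum_norm_le) simp
    then show ?thesis by (simp add: z_def norm_mult sum_move)
  qed
  have zw: "norm (z n - of_real (w n)) \<le> K / (real n * sqrt (real n))" if n: "1 \<le> n" for n
  proof -
    let ?y = "\<lambda>i. u i / sqrt (real n)"
    let ?r = "\<lambda>i. iexp (?y i) - complex_of_real (1 - (?y i)\<^sup>2 / 2) - \<i> * of_real (?y i)"
    have "(\<Sum>i\<in>UNIV. ?y i) = 0"
      using centred by (simp flip: sum_divide_distrib)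
    moreover have "(\<Sum>i\<in>UNIV. (?y i)\<^sup>2) = q / real n"
      by (simp add: power_divide q_def flip: sum_divide_distrib)
    ultimately have
      "(\<Sum>i\<in>UNIV. complex_of_real (1 - (?y i)\<^sup>2 / 2) + \<i> * of_real (?y i)) = of_real (3 - q / real n / 2)"
      by (simp only: sum.distrib sum_distrib_left[symmetric] of_real_sum[symmetric] sum_subtractf sum_divide_distrib[symmetric]) simp
    moreover have "(\<Sum>i\<in>UNIV. ?r i) = (\<Sum>i\<in>UNIV. iexp (?y i)) - (\<Sum>i\<in>UNIV. complex_of_real (1 - (?y i)\<^sup>2 / 2) + \<i> * of_real (?y i))"
      by (simp add: sum_subtractf[symmetric] algebra_simps)
    moreover have "complex_of_real (w n) = (1 / 3) * of_real (3 - q / real n / 2)"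
      by (simp add: w_def field_simps)
    ultimately have "z n - of_real (w n) = (1 / 3) * (\<Sum>i\<in>UNIV. ?r i)"
      by (simp only: z_def right_diff_distrib)
    then have "norm (z n - of_real (w n)) = (1 / 3) * norm (\<Sum>i\<in>UNIV. ?r i)"
      by (simp only: norm_mult) simp
    also have "\<dots> \<le> (1 / 3) * (\<Sum>i\<in>UNIV. \<bar>?y i\<bar> ^ 3 / 6)"
      by (intro mult_left_mono sum_norm_le iexp_quadratic_approx) simp
    also have "(\<Sum>i\<in>UNIV. \<bar>?y i\<bar> ^ 3 / 6) = (\<Sum>i\<in>UNIV. \<bar>u i\<bar> ^ 3) / (6 * (sqrt (real n)) ^ 3)"
      by (simp add: power_divide abs_divide flip: sum_divide_distrib)
    also have "sqrt (real n) ^ 3 = real n * sqrt (real n)"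
      by (simp add: power3_eq_cube)
    finally show ?thesis by (simp add: K_def)
  qed
  have lim_w: "(\<lambda>n. w n ^ T0 n) \<longlonglongrightarrow> exp (- q / 2)"
  proof (cases "q = 0")
    case True
    then show ?thesis by (simp add: w_def)
  next
    case False
    then have q: "0 < q" using q by simp
    have "(\<lambda>n. (3 * (real n - real (nat \<lceil>real n powr (2/3)\<rceil>))) * ln (1 - q / (6 * real n))) \<longlonglongrightarrow> - q / 2"
      using q by real_asymp
    then have "(\<lambda>n. exp ((3 * (real n - real (nat \<lceil>real n powr (2/3)\<rceil>))) * ln (1 - q / (6 * real n)))) \<longlonglongrightarrow> exp (- q / 2)"
      by (rule tendsto_exp)
    moreover have "\<forall>\<^sub>F n in sequentially. 0 < 1 - q / (6 * real n)"
      using q by real_asymp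
    then have "\<forall>\<^sub>F n in sequentially. exp ((3 * (real n - real (nat \<lceil>real n powr (2/3)\<rceil>))) * ln (1 - q / (6 * real n))) = w n ^ T0 n"
      using eventually_ge_at_top[of 1]
    proof eventually_elim
      case (elim n)
      then show ?case
        unfolding w_def by (simp only: real_T0(1)[symmetric] exp_of_nat_mult exp_ln)
    qed
    ultimately show ?thesis by (rule Lim_transform_eventually)
  qed
  have "(\<lambda>n. z n ^ T0 n - of_real (w n) ^ T0 n) \<longlonglongrightarrow> 0"
  proof (rule Lim_null_comparison)
    have "\<forall>\<^sub>F n in sequentially. q / (6 * real n) \<le> 1" by real_asymp
    then show "\<forall>\<^sub>F n in sequentially. norm (z n ^ T0 n - of_real (w n) ^ T0 n) \<le> 3 * K / sqrt (real n)"
      using eventually_ge_at_top[of 1]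
    proof eventually_elim
      case (elim n)
      have "0 \<le> q / (6 * real n)" using q by simp
      then have "norm (complex_of_real (w n)) \<le> 1"
        unfolding norm_of_real w_def using elim by linarith
      then have "norm (z n ^ T0 n - of_real (w n) ^ T0 n) \<le> real (T0 n) * norm (z n - of_real (w n))"
        by (rule norm_power_diff[OF z1])
      also have "\<dots> \<le> (3 * real n) * (K / (real n * sqrt (real n)))"
        using T0_le[of n] zw[OF elim(2)] by (intro mult_mono) auto
      also have "\<dots> = 3 * K / sqrt (real n)" using elim by simp
      finally show ?case .
    qed
    show "(\<lambda>n. 3 * K / sqrt (real n)) \<longlonglongrightarrow> 0" by real_asymp
  qed
  moreover have "(\<lambda>n. complex_of_real (w n) ^ T0 n) \<longlonglongrightarrow> of_real (exp (- q / 2))"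
    using tendsto_of_real[OF lim_w, where 'a=complex] by simp
  ultimately have "(\<lambda>n. (z n ^ T0 n - of_real (w n) ^ T0 n) + of_real (w n) ^ T0 n) \<longlonglongrightarrow> 0 + of_real (exp (- q / 2))"
    by (rule tendsto_add)
  then show ?thesis by (simp add: z_def q_def)
qed

lemma prob_spent_tends_0: "(\<lambda>n. measure_pmf.prob (play uniform (\<sigma> n) (T0 n)) (- unspent n)) \<longlonglongrightarrow> 0"
proof (rule Lim_null_comparison)
  show "\<forall>\<^sub>F n in sequentially. norm (measure_pmf.prob (play uniform (\<sigma> n) (T0 n)) (- unspent n))
     \<le> 9 * real n / (real (nat \<lceil>real n powr (2/3)\<rceil>))\<^sup>2"
    using eventually_ge_at_top[of 1]
  proof eventually_elim
    case (elim n)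
    note T = real_T0[OF elim]
    have "real (T0 n) < real (3 * n)" unfolding T(1) using T(2) by simp
    then have "T0 n < 3 * n" by (simp only: of_nat_less_iff)
    then have "measure_pmf.prob (play uniform (\<sigma> n) (T0 n)) (- unspent n) \<le> 3 * real (T0 n) / (real n - real (T0 n) / 3)\<^sup>2"
      by (rule prob_spent_uniform)
    also have "real n - real (T0 n) / 3 = real (nat \<lceil>real n powr (2/3)\<rceil>)"
      unfolding T(1) by (simp add: diff_divide_distrib)
    also have "3 * real (T0 n) / (real (nat \<lceil>real n powr (2/3)\<rceil>))\<^sup>2 \<le> 9 * real n / (real (nat \<lceil>real n powr (2/3)\<rceil>))\<^sup>2"
      using T0_le[of n] by (intro divide_right_mono) auto
    finally show ?case by simp
  qed
  show "(\<lambda>n. 9 * real n / (real (nat \<lceil>real n powr (2/3)\<rceil>))\<^sup>2) \<longlonglongrightarrow> 0" by real_asymp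
qed

text \<open>Limits of bounded functionals of the first \<open>T0 n\<close> rounds may be computed in the uniform
  game.\<close>

lemma greedy_uniform_limit:
  fixes f :: "nat \<Rightarrow> history \<Rightarrow> complex"
  assumes "\<And>n h. norm (f n h) \<le> 1"
    and "(\<lambda>n. expect (play uniform (\<sigma> n) (T0 n)) (f n)) \<longlonglongrightarrow> l"
  shows "(\<lambda>n. expect (play (greedy n) (\<sigma> n) (3 * n)) (\<lambda>h. f n (take (T0 n) h))) \<longlonglongrightarrow> l"
proof -
  have "(\<lambda>n. expect (play (greedy n) (\<sigma> n) (T0 n)) (f n) - expect (play uniform (\<sigma> n) (T0 n)) (f n)) \<longlonglongrightarrow> 0"
  proof (rule Lim_null_comparison)
    show "\<forall>\<^sub>F n in sequentially. norm (expect (play (greedy n) (\<sigma> n) (T0 n)) (f n) - expect (play uniform (\<sigma> n) (T0 n)) (f n))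
       \<le> 2 * measure_pmf.prob (play uniform (\<sigma> n) (T0 n)) (- unspent n)"
      using expect_greedy_uniform_diff[OF assms(1)] by simp
    show "(\<lambda>n. 2 * measure_pmf.prob (play uniform (\<sigma> n) (T0 n)) (- unspent n)) \<longlonglongrightarrow> 0"
      using tendsto_mult_right_zero[OF prob_spent_tends_0] .
  qed
  from tendsto_add[OF this assms(2)] show ?thesis
    by (simp add: expect_take_play[OF T0_le])
qed

lemma real_distribution_game:
  "real_distribution (distr (greedy_game n \<sigma>) borel X)"
  unfolding greedy_game_def by (rule prob_space.real_distribution_distr[OF prob_space_measure_pmf]) simp

lemma char_game: "char (distr (greedy_game n \<sigma>) borel X) t = expect (play (greedy n) \<sigma> (3 * n)) (\<lambda>h. iexp (t * X h))"
  unfolding char_def greedy_game_def by (subst integral_distr) auto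

lemma real_distribution_W_law: "real_distribution W_law"
  unfolding W_law_def using prob_space_normal_density
  by (auto simp: real_distribution_def real_distribution_axioms_def)

lemma char_W_law: "char W_law t = exp (- t\<^sup>2)"
proof -
  interpret N: prob_space std_normal_distribution by (rule prob_space_normal_density) simp
  have "distr std_normal_distribution lborel (\<lambda>x. x) = distr std_normal_distribution std_normal_distribution (\<lambda>x. x)"
    by (rule distr_cong) auto
  then have "distributed std_normal_distribution lborel (\<lambda>x. x) std_normal_density"
    by (simp add: distributed_def distr_id)
  from N.normal_density_affine[OF this, of "sqrt 2" 0]
  have "distributed std_normal_distribution lborel (\<lambda>x. sqrt 2 * x) (normal_density 0 (sqrt 2))"
    by simp
  then have W: "W_law = distr std_normal_distribution borel (\<lambda>x. sqrt 2 * x)"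
    unfolding W_law_def by (subst distributed_distr_eq_density[symmetric]) (auto intro: distr_cong)
  have "char W_law t = char std_normal_distribution (t * sqrt 2)"
    unfolding W char_def by (subst integral_distr) (auto simp: mult_ac)
  then show ?thesis
    by (simp add: char_std_normal_distribution power_mult_distrib)
qed

lemma sum_list_scaled_int: "(\<Sum>m\<leftarrow>h. c * real_of_int (f m)) = c * of_int (\<Sum>m\<leftarrow>h. f m)"
  by (induction h) (auto simp: distrib_left)

text \<open>For each move \<open>s\<close> of N, the score of the round is a permutation of the same three values as
  the move of R varies; \<open>s = 0\<close> serves as representative.\<close>

lemma char_uniform_score:
  "expect (play uniform \<sigma> t) (\<lambda>h. iexp (c * of_int (score h t)))
    = ((1 / 3) * (\<Sum>i\<in>UNIV. iexp (c * of_int (round_score (i, 0))))) ^ t"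
proof -
  have "expect (play uniform \<sigma> t) (\<lambda>h. iexp (c * of_int (score h t)))
      = expect (play uniform \<sigma> t) (\<lambda>h. iexp (\<Sum>m\<leftarrow>h. c * of_int (round_score m)))"
  proof (rule expect_cong_pmf)
    fix h assume "h \<in> set_pmf (play uniform \<sigma> t)"
    then have "take t h = h" by (simp add: play_length)
    then show "iexp (c * of_int (score h t)) = iexp (\<Sum>m\<leftarrow>h. c * of_int (round_score m))"
      by (simp only: score_def sum_list_scaled_int)
  qed
  also have "\<dots> = ((1 / 3) * (\<Sum>i\<in>UNIV. iexp (c * of_int (round_score (i, 0))))) ^ t"
  proof (rule expect_iexp_sum_list, rule expect_pair_const)
    fix h s
    show "expect (uniform h) (\<lambda>r. iexp (c * of_int (round_score (r, s)))) =
      (1 / 3) * (\<Sum>i\<in>UNIV. iexp (c * of_int (round_score (i, 0))))"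
      using move_exhaust[of s]
      by (elim disjE) (simp_all add: expect_uniform sum_move round_score_def scaleR_conv_of_real add_ac)
  qed
  finally show ?thesis .
qed

theorem early_score_converges:
  "weak_conv_m (\<lambda>n. distr (greedy_game n (\<sigma> n)) borel (early_score n)) W_law"
proof (rule levy_continuity[OF real_distribution_game real_distribution_W_law])
  fix \<theta> :: real
  define u where "u i = \<theta> * of_int (round_score (i, 0))" for i
  have "(\<lambda>n. ((1 / 3) * (\<Sum>i\<in>UNIV. iexp (u i / sqrt (real n)))) ^ T0 n)
      \<longlonglongrightarrow> complex_of_real (exp (- (\<Sum>i\<in>UNIV. (u i)\<^sup>2) / 2))"
    by (rule three_point_char_limit) (simp add: u_def sum_move round_score_def)
  also have "(\<Sum>i\<in>UNIV. (u i)\<^sup>2) = 2 * \<theta>\<^sup>2"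
    by (simp add: u_def sum_move round_score_def)
  finally have "(\<lambda>n. expect (play uniform (\<sigma> n) (T0 n)) (\<lambda>h. iexp (\<theta> / sqrt (real n) * of_int (score h (T0 n)))))
      \<longlonglongrightarrow> complex_of_real (exp (- (2 * \<theta>\<^sup>2) / 2))"
    unfolding char_uniform_score u_def by (simp only: times_divide_eq_left)
  then have "(\<lambda>n. expect (play (greedy n) (\<sigma> n) (3 * n))
       (\<lambda>h. iexp (\<theta> / sqrt (real n) * of_int (score (take (T0 n) h) (T0 n))))) \<longlonglongrightarrow> complex_of_real (exp (- (2 * \<theta>\<^sup>2) / 2))"
    by (intro greedy_uniform_limit) simp_all
  then show "(\<lambda>n. char (distr (greedy_game n (\<sigma> n)) borel (early_score n)) \<theta>) \<longlonglongrightarrow> char W_law \<theta>"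
    by (simp add: char_game char_W_law early_score_def score_def)
qed

section \<open>The late score\<close>

lemma measurable_mv_normal_map [measurable]:
  fixes A :: "real^'n^'n"
  shows "(\<lambda>x. A *v (\<chi> i. x i)) \<in> Pi\<^sub>M UNIV (\<lambda>_. std_normal_distribution) \<rightarrow>\<^sub>M borel"
proof -
  have "(\<lambda>x. A *v (\<chi> i. x i)) = (\<lambda>x. \<Sum>i\<in>UNIV. x i *\<^sub>R column i A)"
    by (simp add: fun_eq_iff matrix_mult_sum scalar_mult_eq_scaleR)
  moreover have "(\<lambda>x. \<Sum>i\<in>UNIV. x i *\<^sub>R column i A) \<in> Pi\<^sub>M UNIV (\<lambda>_. std_normal_distribution) \<rightarrow>\<^sub>M borel"
    by measurable
  ultimately show ?thesis by simp
qed

lemma prob_space_std_normal_PiM: "prob_space (Pi\<^sub>M UNIV (\<lambda>_. std_normal_distribution))"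
  by (intro prob_space_PiM prob_space_normal_density) simp

lemma prob_space_mv_normal: "prob_space (mv_normal \<Sigma>)"
  unfolding mv_normal_def
  by (intro prob_space.prob_space_distr prob_space_std_normal_PiM measurable_mv_normal_map)

lemma sets_mv_normal: "sets (mv_normal \<Sigma>) = sets borel"
  by (simp add: mv_normal_def)

text \<open>The law is a linear image of a product measure, so the integral factorizes over the
  components; \<open>\<theta> \<bullet> column k A\<close> is the coefficient of the \<open>k\<close>-th standard
  normal variable.\<close>

lemma char_mv_normal:
  fixes \<Sigma> :: "real^'n^'n"
  shows "(\<integral>z. iexp (\<theta> \<bullet> z) \<partial>mv_normal \<Sigma>) = exp (- (\<Sum>k\<in>UNIV. (\<theta> \<bullet> column k (psd_sqrt \<Sigma>))\<^sup>2) / 2)"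
proof -
  define w where "w k = \<theta> \<bullet> column k (psd_sqrt \<Sigma>)" for k
  interpret product_sigma_finite "\<lambda>_::'n. std_normal_distribution"
    unfolding product_sigma_finite_def
    by (intro allI prob_space_imp_sigma_finite prob_space_normal_density) simp
  have lin: "\<theta> \<bullet> (psd_sqrt \<Sigma> *v (\<chi> i. x i)) = (\<Sum>k\<in>UNIV. w k * x k)" for x
    by (simp add: matrix_mult_sum scalar_mult_eq_scaleR inner_sum_right w_def mult.commute)
  have int: "integrable std_normal_distribution (\<lambda>x. iexp (w k * x))" for k
  proof -
    interpret prob_space std_normal_distribution by (rule prob_space_normal_density) simp
    show ?thesis by (rule integrable_const_bound[where B=1]) auto
  qed
  have "(\<integral>z. iexp (\<theta> \<bullet> z) \<partial>mv_normal \<Sigma>) = (\<integral>x. iexp (\<Sum>k\<in>UNIV. w k * x k) \<partial>Pi\<^sub>M UNIV (\<lambda>_. std_normal_distribution))"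
    unfolding mv_normal_def by (subst integral_distr) (auto simp only: lin intro!: measurable_mv_normal_map, measurable)
  also have "\<dots> = (\<integral>x. (\<Prod>k\<in>UNIV. iexp (w k * x k)) \<partial>Pi\<^sub>M UNIV (\<lambda>_. std_normal_distribution))"
    by (simp add: exp_sum sum_distrib_left)
  also have "\<dots> = (\<Prod>k\<in>UNIV. \<integral>x. iexp (w k * x) \<partial>std_normal_distribution)"
    by (rule product_integral_prod[OF finite int])
  also have "\<dots> = (\<Prod>k\<in>UNIV. char std_normal_distribution (w k))"
    by (simp add: char_def)
  also have "\<dots> = (\<Prod>k\<in>UNIV. complex_of_real (exp (- (w k)\<^sup>2 / 2)))"
    by (simp add: char_std_normal_distribution)
  also have "\<dots> = complex_of_real (exp (\<Sum>k\<in>UNIV. - (w k)\<^sup>2 / 2))"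
    by (simp only: exp_sum[OF finite] of_real_prod)
  also have "(\<Sum>k\<in>UNIV. - (w k)\<^sup>2 / 2) = - (\<Sum>k\<in>UNIV. (w k)\<^sup>2) / 2"
    by (simp add: sum_negf sum_divide_distrib)
  finally show ?thesis by (simp add: w_def)
qed

lemma minus_one_move: "(- 1 :: move) = 2"
  by simp

text \<open>The quadratic form of \<open>Z_cov\<close> is a sum of squared cyclic differences, which is how it arises
  as the limiting covariance of the leads.\<close>

lemma char_Z:
  "(\<integral>z. iexp (\<theta> \<bullet> z) \<partial>mv_normal Z_cov) = exp (- (\<Sum>r\<in>UNIV. (\<theta> $ r - \<theta> $ (r - 1))\<^sup>2) / 2)"
proof -
  have "(\<theta> \<bullet> column k (psd_sqrt Z_cov)) = (3 * \<theta> $ k - (\<theta> $ 0 + (\<theta> $ 1 + \<theta> $ 2))) / sqrt 3" for k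
    using move_exhaust[of k] unfolding psd_sqrt_Z_cov
    by (elim disjE) (simp_all add: inner_vec_def column_def sum_move Z_cov_def field_simps)
  then have "(\<Sum>k\<in>UNIV. (\<theta> \<bullet> column k (psd_sqrt Z_cov))\<^sup>2) =
      (\<Sum>k\<in>UNIV. (3 * \<theta> $ k - (\<theta> $ 0 + (\<theta> $ 1 + \<theta> $ 2)))\<^sup>2 / 3)"
    by (simp only: power_divide) simp
  also have "\<dots> = (\<Sum>r\<in>UNIV. (\<theta> $ r - \<theta> $ (r - 1))\<^sup>2)"
    by (simp add: sum_move minus_one_move power2_eq_square field_simps)
  finally have "(\<Sum>k\<in>UNIV. (\<theta> \<bullet> column k (psd_sqrt Z_cov))\<^sup>2) = (\<Sum>r\<in>UNIV. (\<theta> $ r - \<theta> $ (r - 1))\<^sup>2)" .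
  then show ?thesis by (simp only: char_mv_normal)
qed

lemma continuous_Max_coordinates: "continuous_on S (\<lambda>z::real^3. Max (range (\<lambda>i. z $ i)))"
proof -
  have "Max (range (\<lambda>i. z $ i)) = max (z $ 0) (max (z $ 1) (z $ 2))" for z :: "real^3"
    unfolding UNIV_move by simp
  then show ?thesis by (auto intro!: continuous_intros)
qed

lemma measurable_Max_coordinates [measurable]: "(\<lambda>z::real^3. Max (range (\<lambda>i. z $ i))) \<in> borel_measurable borel"
  by (rule borel_measurable_continuous_onI[OF continuous_Max_coordinates])

lemma measurable_mv_normal: "measurable (mv_normal \<Sigma>) N = measurable borel N"
  by (rule measurable_cong_sets[OF sets_mv_normal refl])

lemma real_distribution_Zmax_law: "real_distribution Zmax_law"
  unfolding Zmax_law_def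
  by (intro prob_space.real_distribution_distr[OF prob_space_mv_normal])
     (simp add: measurable_mv_normal measurable_Max_coordinates)

lemma char_Zmax_law: "char Zmax_law t = (\<integral>z. iexp (t * Max (range (\<lambda>i. z $ i))) \<partial>mv_normal Z_cov)"
  unfolding char_def Zmax_law_def
  by (subst integral_distr) (auto simp: measurable_mv_normal measurable_Max_coordinates)

definition lead_vector :: "nat \<Rightarrow> history \<Rightarrow> real^3" where
  "lead_vector n h = (\<chi> j. lead j h / sqrt (real n))"

text \<open>A use of the move \<open>r\<close> raises \<open>lead r\<close> and lowers \<open>lead (r - 1)\<close>.\<close>

lemma inner_lead_vector:
  "\<theta> \<bullet> lead_vector n h = (\<Sum>m\<leftarrow>h. (\<theta> $ fst m - \<theta> $ (fst m - 1)) / sqrt (real n))"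
proof (induction h rule: rev_induct)
  case Nil
  show ?case by (simp add: lead_vector_def lead_def inner_vec_def)
next
  case (snoc m h)
  have "\<theta> \<bullet> lead_vector n (h @ [m]) = \<theta> \<bullet> lead_vector n h + (\<theta> $ fst m - \<theta> $ (fst m - 1)) / sqrt (real n)"
    using move_exhaust[of "fst m"]
    by (elim disjE) (simp_all add: lead_vector_def lead_def inner_vec_def sum_move minus_one_move add_divide_distrib diff_divide_distrib algebra_simps)
  then show ?case using snoc by simp
qed

lemma lead_vector_char_limit:
  "(\<lambda>n. \<integral>x. iexp (\<theta> \<bullet> x) \<partial>distr (measure_pmf (play uniform (\<sigma> n) (T0 n))) borel (lead_vector n))
    \<longlonglongrightarrow> (\<integral>z. iexp (\<theta> \<bullet> z) \<partial>mv_normal Z_cov)"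
proof -
  define u where "u r = \<theta> $ r - \<theta> $ (r - 1)" for r
  have "(\<integral>x. iexp (\<theta> \<bullet> x) \<partial>distr (measure_pmf (play uniform (\<sigma> n) (T0 n))) borel (lead_vector n)) =
     ((1 / 3) * (\<Sum>i\<in>UNIV. iexp (u i / sqrt (real n)))) ^ T0 n" for n
  proof -
    have "(\<integral>x. iexp (\<theta> \<bullet> x) \<partial>distr (measure_pmf (play uniform (\<sigma> n) (T0 n))) borel (lead_vector n)) =
      expect (play uniform (\<sigma> n) (T0 n)) (\<lambda>h. iexp (\<Sum>m\<leftarrow>h. u (fst m) / sqrt (real n)))"
      by (subst integral_distr) (auto simp: inner_lead_vector u_def)
    also have "\<dots> = ((1 / 3) * (\<Sum>i\<in>UNIV. iexp (u i / sqrt (real n)))) ^ T0 n"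
      by (intro expect_iexp_sum_list expect_pair_const)
         (simp add: expect_uniform sum_move scaleR_conv_of_real)
    finally show ?thesis .
  qed
  moreover have "(\<lambda>n. ((1 / 3) * (\<Sum>i\<in>UNIV. iexp (u i / sqrt (real n)))) ^ T0 n)
      \<longlonglongrightarrow> complex_of_real (exp (- (\<Sum>i\<in>UNIV. (u i)\<^sup>2) / 2))"
    by (rule three_point_char_limit) (simp add: u_def sum_move minus_one_move)
  ultimately show ?thesis
    by (simp only: char_Z u_def)
qed

lemma top_lead_vector: "Max (range (\<lambda>i. lead_vector n h $ i)) = top_lead h / sqrt (real n)"
proof -
  have "mono (\<lambda>x. x / sqrt (real n))" by (simp add: mono_def divide_right_mono)
  from mono_Max_commute[OF this, of "range (\<lambda>j. lead j h)"] show ?thesis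
    by (simp add: lead_vector_def top_lead_def image_image)
qed

lemma top_lead_limit:
  "(\<lambda>n. expect (play uniform (\<sigma> n) (T0 n)) (\<lambda>h. iexp (t * (top_lead h / sqrt (real n))))) \<longlonglongrightarrow> char Zmax_law t"
proof -
  have "(\<lambda>n. \<integral>x. iexp (t * Max (range (\<lambda>i. x $ i))) \<partial>distr (measure_pmf (play uniform (\<sigma> n) (T0 n))) borel (lead_vector n))
    \<longlonglongrightarrow> (\<integral>z. iexp (t * Max (range (\<lambda>i. z $ i))) \<partial>mv_normal Z_cov)"
    by (rule char_distr_continuous_converges[OF _ _ prob_space_mv_normal sets_mv_normal lead_vector_char_limit])
       (auto intro!: measure_pmf.prob_space_distr continuous_on_mult continuous_on_const continuous_Max_coordinates)
  moreover have "(\<integral>x. iexp (t * Max (range (\<lambda>i. x $ i))) \<partial>distr (measure_pmf (play uniform (\<sigma> n) (T0 n))) borel (lead_vector n))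
     = expect (play uniform (\<sigma> n) (T0 n)) (\<lambda>h. iexp (t * (top_lead h / sqrt (real n))))" for n
    by (subst integral_distr) (auto simp only: top_lead_vector, auto)
  ultimately show ?thesis by (simp only: char_Zmax_law)
qed

lemma norm_iexp_diff: "norm (iexp x - iexp y) \<le> \<bar>x - y\<bar>"
proof -
  have "iexp x - iexp y = iexp y * (iexp (x - y) - 1)"
    by (simp add: exp_diff right_diff_distrib)
  then have "norm (iexp x - iexp y) = norm (iexp (x - y) - 1)"
    by (simp only: norm_mult norm_exp_i_times mult_1_left)
  then show ?thesis using iexp_approx1[of "x - y" 0] by simp
qed

lemma late_rounds_negligible: "(\<lambda>n. sqrt (3 * real n - real (T0 n)) / sqrt (real n)) \<longlonglongrightarrow> 0"
proof (rule Lim_transform_eventually)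
  show "(\<lambda>n. sqrt (3 * real (nat \<lceil>real n powr (2/3)\<rceil>)) / sqrt (real n)) \<longlonglongrightarrow> 0" by real_asymp
  show "\<forall>\<^sub>F n in sequentially. sqrt (3 * real (nat \<lceil>real n powr (2/3)\<rceil>)) / sqrt (real n) = sqrt (3 * real n - real (T0 n)) / sqrt (real n)"
    using eventually_ge_at_top[of 1]
  proof eventually_elim
    case (elim n)
    have "3 * real (nat \<lceil>real n powr (2/3)\<rceil>) = 3 * real n - real (T0 n)"
      unfolding real_T0(1)[OF elim] by (simp add: right_diff_distrib)
    then show ?case by (simp only:)
  qed
qed

theorem late_score_converges:
  assumes ns: "\<And>n. non_stupid n (\<sigma> n)"
  shows "weak_conv_m (\<lambda>n. distr (greedy_game n (\<sigma> n)) borel (late_score n)) Zmax_law"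
proof (rule levy_continuity[OF real_distribution_game real_distribution_Zmax_law])
  fix t :: real
  define L where "L n h = top_lead (take (T0 n) h) / sqrt (real n)" for n h
  let ?E = "\<lambda>n. expect (play (greedy n) (\<sigma> n) (3 * n))"
  have "(\<lambda>n. ?E n (\<lambda>h. iexp (t * L n h))) \<longlonglongrightarrow> char Zmax_law t"
    unfolding L_def by (intro greedy_uniform_limit top_lead_limit) simp
  moreover have "(\<lambda>n. ?E n (\<lambda>h. iexp (t * late_score n h)) - ?E n (\<lambda>h. iexp (t * L n h))) \<longlonglongrightarrow> 0"
  proof (rule Lim_null_comparison)
    show "\<forall>\<^sub>F n in sequentially. norm (?E n (\<lambda>h. iexp (t * late_score n h)) - ?E n (\<lambda>h. iexp (t * L n h)))
       \<le> \<bar>t\<bar> * 12 * (sqrt (3 * real n - real (T0 n)) / sqrt (real n))"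
      using eventually_ge_at_top[of 1]
    proof eventually_elim
      case (elim n)
      let ?D = "\<lambda>h. \<bar>of_int (score h (3 * n) - score h (T0 n)) - top_lead (take (T0 n) h)\<bar>"
      have "norm (?E n (\<lambda>h. iexp (t * late_score n h)) - ?E n (\<lambda>h. iexp (t * L n h)))
         = norm (?E n (\<lambda>h. iexp (t * late_score n h) - iexp (t * L n h)))"
        by (simp only: Bochner_Integration.integral_diff[OF integrable_play integrable_play])
      also have "\<dots> \<le> ?E n (\<lambda>h. norm (iexp (t * late_score n h) - iexp (t * L n h)))"
        by (rule integral_norm_bound)
      also have "\<dots> \<le> ?E n (\<lambda>h. \<bar>t\<bar> / sqrt (real n) * ?D h)"
      proof (intro integral_mono integrable_play)
        fix h
        have "norm (iexp (t * late_score n h) - iexp (t * L n h)) \<le> \<bar>t * late_score n h - t * L n h\<bar>"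
          by (rule norm_iexp_diff)
        also have "t * late_score n h - t * L n h =
           t / sqrt (real n) * (of_int (score h (3 * n) - score h (T0 n)) - top_lead (take (T0 n) h))"
          by (simp add: late_score_def L_def right_diff_distrib diff_divide_distrib)
        also have "\<bar>\<dots>\<bar> = \<bar>t\<bar> / sqrt (real n) * ?D h"
          by (simp only: abs_mult abs_divide) simp
        finally show "norm (iexp (t * late_score n h) - iexp (t * L n h)) \<le> \<bar>t\<bar> / sqrt (real n) * ?D h" .
      qed
      also have "\<dots> = \<bar>t\<bar> / sqrt (real n) * ?E n ?D"
        by (rule integral_mult_right_zero)
      also have "\<dots> \<le> \<bar>t\<bar> / sqrt (real n) * (12 * sqrt (3 * real n - real (T0 n)))"
        using elim by (intro mult_left_mono expect_late_error[OF ns T0_le]) auto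
      finally show ?case by (simp add: field_simps)
    qed
    show "(\<lambda>n. \<bar>t\<bar> * 12 * (sqrt (3 * real n - real (T0 n)) / sqrt (real n))) \<longlonglongrightarrow> 0"
      by (rule tendsto_mult_right_zero[OF late_rounds_negligible])
  qed
  ultimately have "(\<lambda>n. (?E n (\<lambda>h. iexp (t * late_score n h)) - ?E n (\<lambda>h. iexp (t * L n h))) + ?E n (\<lambda>h. iexp (t * L n h))) \<longlonglongrightarrow> 0 + char Zmax_law t"
    by (intro tendsto_add)
  then show "(\<lambda>n. char (distr (greedy_game n (\<sigma> n)) borel (late_score n)) t) \<longlonglongrightarrow> char Zmax_law t"
    by (simp add: char_game)
qed

section \<open>A strategy that makes the two terms dependent\<close>

text \<open>N plays \<open>0\<close> while R has all moves. Afterwards he plays \<open>i + 1\<close>, which never loses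
  when R is left with \<open>i\<close> alone or with \<open>i\<close> and \<open>i + 1\<close>.\<close>

definition stubborn :: "nat \<Rightarrow> strategy" where
  "stubborn n h = return_pmf (let A = available n h in
     if A = UNIV then 0 else (THE i. A = {i} \<or> A = {i, i + 1}) + 1)"

lemma non_stupid_stubborn: "non_stupid n (stubborn n)"
proof -
  have ne: "{i} \<noteq> {k, k + 1}" "{k, k + 1} \<noteq> {i}" for i k :: move
    by (metis insertI1 insert_subset order_refl singletonD succ_neq_move(1))+
  have "(THE k. {i} = {k} \<or> {i} = {k, k + 1}) = i" for i :: move
    using ne by blast
  moreover have "(THE k. {i, i + 1} = {k} \<or> {i, i + 1} = {k, k + 1}) = i" for i :: move
    unfolding two_moves_inject using ne by blast
  ultimately show ?thesis
    by (simp add: non_stupid_def stubborn_def two_moves_not_all Let_def)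
qed

text \<open>Against the constant move \<open>0\<close>, R loses a round exactly when she plays \<open>2\<close> and wins
  exactly when she plays \<open>1\<close>.\<close>

lemma score_stubborn:
  assumes "h \<in> set_pmf (play \<rho> (stubborn n) t)" "h \<in> unspent n"
  shows "of_int (score h t) = - lead 1 h"
  using assms
proof (induction t arbitrary: h)
  case 0
  then show ?case by (simp add: score_def lead_def)
next
  case (Suc t)
  then obtain h' r s where h: "h = h' @ [(r, s)]" "h' \<in> set_pmf (play \<rho> (stubborn n) t)"
    "s \<in> set_pmf (stubborn n h')" by auto
  have un: "h' \<in> unspent n" using Suc.prems(2) h(1) unspent_prefix by blast
  then have "s = 0" using h(3) by (simp add: stubborn_def unspent_available)
  moreover have "length h' = t" using h(2) play_length by blast
  moreover have "of_int (score h' t) = - lead 1 h'" using Suc.IH h(2) un by blast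
  ultimately show ?case
    using move_exhaust[of r] unfolding h(1)
    by (elim disjE) (simp_all add: score_def lead_def round_score_def)
qed

text \<open>The early score \<open>- lead 1\<close> cancels against the lower bound \<open>lead 1\<close> for the late score;
  what remains is a martingale over the few late rounds.\<close>

lemma prob_total_score_stubborn_negative:
  "(\<lambda>n. measure_pmf.prob (play (greedy n) (stubborn n) (3 * n)) {h. total_score n h \<le> - (1/2)}) \<longlonglongrightarrow> 0"
proof (rule Lim_null_comparison)
  let ?p = "\<lambda>n. measure_pmf.prob (play uniform (stubborn n) (T0 n)) (- unspent n)"
  have "(\<lambda>n. ?p n + 64 * (sqrt (3 * real n - real (T0 n)) / sqrt (real n))\<^sup>2) \<longlonglongrightarrow> 0 + 64 * 0\<^sup>2"
    by (intro tendsto_intros prob_spent_tends_0 late_rounds_negligible)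
  then show "(\<lambda>n. ?p n + 64 * (sqrt (3 * real n - real (T0 n)) / sqrt (real n))\<^sup>2) \<longlonglongrightarrow> 0" by simp
  show "\<forall>\<^sub>F n in sequentially. norm (measure_pmf.prob (play (greedy n) (stubborn n) (3 * n)) {h. total_score n h \<le> - (1/2)})
     \<le> ?p n + 64 * (sqrt (3 * real n - real (T0 n)) / sqrt (real n))\<^sup>2"
    using eventually_ge_at_top[of 1]
  proof eventually_elim
    case (elim n)
    let ?P = "play (greedy n) (stubborn n) (3 * n)"
    let ?X = "late_noise n (T0 n) 1"
    let ?B = "indicat_real (- unspent n)"
    have "measure_pmf.prob ?P {h. total_score n h \<le> - (1/2)} = expect ?P (indicat_real {h. total_score n h \<le> - (1/2)})"
      by simp
    also have "\<dots> \<le> expect ?P (\<lambda>h. ?B (take (T0 n) h) + 4 / real n * (?X h)\<^sup>2)"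
    proof (intro integral_mono_AE integrable_play)
      show "AE h in measure_pmf ?P. indicat_real {h. total_score n h \<le> - (1/2)} h
          \<le> ?B (take (T0 n) h) + 4 / real n * (?X h)\<^sup>2"
        unfolding AE_measure_pmf_iff
      proof
        fix h assume h: "h \<in> set_pmf ?P"
        have "1 \<le> 4 / real n * (?X h)\<^sup>2" if un: "take (T0 n) h \<in> unspent n" and low: "total_score n h \<le> - (1/2)"
        proof -
          have "take (T0 n) h \<in> set_pmf (map_pmf (take (T0 n)) ?P)" using h by simp
          then have "take (T0 n) h \<in> set_pmf (play (greedy n) (stubborn n) (T0 n))"
            by (simp only: take_play[OF T0_le])
          then have "of_int (score (take (T0 n) h) (T0 n)) = - lead 1 (take (T0 n) h)"
            by (rule score_stubborn[OF _ un])
          then have "?X h \<le> of_int (score h (3 * n))"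
            using late_score_lower[OF h T0_le, of 1] by (simp add: score_def)
          also have "\<dots> \<le> - sqrt (real n) / 2"
            using low elim by (simp add: total_score_def field_simps)
          finally have "(sqrt (real n) / 2)\<^sup>2 \<le> (- ?X h)\<^sup>2"
            by (intro power_mono) auto
          then show ?thesis using elim by (simp add: power_divide field_simps)
        qed
        then show "indicat_real {h. total_score n h \<le> - (1/2)} h \<le> ?B (take (T0 n) h) + 4 / real n * (?X h)\<^sup>2"
          by (cases "take (T0 n) h \<in> unspent n") (auto simp: indicator_def)
      qed
    qed
    also have "\<dots> = expect ?P (\<lambda>h. ?B (take (T0 n) h)) + 4 / real n * expect ?P (\<lambda>h. (?X h)\<^sup>2)"
      by (simp add: integrable_play)
    also have "expect ?P (\<lambda>h. ?B (take (T0 n) h)) = ?p n"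
      by (simp add: expect_take_play[OF T0_le] prob_spent_greedy_eq_uniform)
    also have "4 / real n * expect ?P (\<lambda>h. (?X h)\<^sup>2) \<le> 4 / real n * (16 * (3 * real n - real (T0 n)))"
      by (intro mult_left_mono late_noise_second_moment non_stupid_stubborn T0_le) simp
    also have "\<dots> = 64 * (sqrt (3 * real n - real (T0 n)) / sqrt (real n))\<^sup>2"
      using T0_le[of n] by (simp add: power_divide)
    finally show ?case by simp
  qed
qed

text \<open>There is a continuity point of the limiting distribution function between \<open>a\<close> and
  \<open>b\<close>, because atoms are countable; so no continuity of the limit law has to be checked.\<close>

lemma weak_conv_measure_atMost:
  assumes M: "\<And>n. real_distribution (M n)" and M': "real_distribution M'"
    and conv: "weak_conv_m M M'" and ab: "a < b" and c: "c < measure M' {..a}"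
  shows "\<forall>\<^sub>F n in sequentially. c < measure (M n) {..b}"
proof -
  interpret M': real_distribution M' by fact
  have "uncountable ({a<..<b} - {x. 0 < measure M' {x}})"
    using ab M'.countable_atoms by (simp add: uncountable_minus_countable uncountable_open_interval)
  then obtain y where "y \<in> {a<..<b} - {x. 0 < measure M' {x}}"
    by (metis countable_empty ex_in_conv)
  then have y: "a < y" "y < b" "measure M' {y} = 0"
    by (auto simp: zero_less_measure_iff)
  have "(\<lambda>n. cdf (M n) y) \<longlonglongrightarrow> cdf M' y"
    using conv y(3) by (simp add: weak_conv_m_def weak_conv_def M'.isCont_cdf)
  moreover have "c < cdf M' y"
    using c y(1) M'.cdf_nondecreasing[of a y] by (simp add: cdf_def)
  ultimately have "\<forall>\<^sub>F n in sequentially. c < cdf (M n) y"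
    by (rule order_tendstoD)
  then show ?thesis
  proof eventually_elim
    case (elim n)
    interpret real_distribution "M n" by (rule M)
    show ?case using elim cdf_nondecreasing[of y b] y(2) by (simp add: cdf_def)
  qed
qed

lemma W_law_atMost_pos: "0 < measure W_law {..x}"
proof -
  interpret W: real_distribution W_law by (rule real_distribution_W_law)
  have "emeasure W_law {..x} \<noteq> 0"
  proof
    assume "emeasure W_law {..x} = 0"
    then have "{..x} \<in> null_sets W_law" by (simp add: null_sets_def)
    then have "AE y in lborel. y \<in> {..x} \<longrightarrow> normal_density 0 (sqrt 2) y \<le> 0"
      unfolding W_law_def by (subst (asm) null_sets_density_iff) auto
    then have "AE y in lborel. y \<notin> {..x}"
      by eventually_elim (use normal_density_pos[of "sqrt 2" 0] in \<open>auto simp: not_le[symmetric]\<close>)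
    then have "{..x} \<in> null_sets lborel"
      by (subst AE_iff_null_sets) auto
    then have "emeasure lborel {x-1..x} = 0"
      by (intro null_setsD1[OF null_sets_subset]) auto
    then show False by simp
  qed
  then show ?thesis by (simp add: W.emeasure_eq_measure zero_less_measure_iff)
qed

lemma convolution_atMost_ge:
  assumes "real_distribution M" "real_distribution N"
  shows "real_distribution (M \<star> N)" "measure M {..a} * measure N {..b} \<le> measure (M \<star> N) {..a + b}"
proof -
  interpret M: real_distribution M by fact
  interpret N: real_distribution N by fact
  interpret P: pair_prob_space M N ..
  have plus [measurable]: "(\<lambda>(x, y). x + y) \<in> M \<Otimes>\<^sub>M N \<rightarrow>\<^sub>M (borel :: real measure)"
    by (simp add: measurable_cong_sets[OF sets_pair_measure_cong[OF M.events_eq_borel N.events_eq_borel] refl])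
  show "real_distribution (M \<star> N)"
    unfolding convolution_def by (rule P.real_distribution_distr) measurable
  have "measure M {..a} * measure N {..b} = measure (M \<Otimes>\<^sub>M N) ({..a} \<times> {..b})"
    by (simp add: measure_def N.emeasure_pair_measure_Times enn2real_mult)
  also have "\<dots> \<le> measure (M \<Otimes>\<^sub>M N) ((\<lambda>(x, y). x + y) -` {..a + b} \<inter> space (M \<Otimes>\<^sub>M N))"
    by (intro P.finite_measure_mono measurable_sets[OF plus]) (auto simp: space_pair_measure)
  also have "\<dots> = measure (M \<star> N) {..a + b}"
    unfolding convolution_def by (subst measure_distr[OF plus]) auto
  finally show "measure M {..a} * measure N {..b} \<le> measure (M \<star> N) {..a + b}" .
qed

theorem theorem5p1:
  "(\<forall>\<sigma> :: nat \<Rightarrow> strategy. (\<forall>n. non_stupid n (\<sigma> n)) \<longrightarrow>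
      weak_conv_m (\<lambda>n. distr (greedy_game n (\<sigma> n)) borel (early_score n)) W_law \<and>
      weak_conv_m (\<lambda>n. distr (greedy_game n (\<sigma> n)) borel (late_score n)) Zmax_law) \<and>
   (\<exists>\<sigma> :: nat \<Rightarrow> strategy. (\<forall>n. non_stupid n (\<sigma> n)) \<and>
      (\<forall>\<^sub>F n in sequentially.
         \<not> prob_space.indep_var (greedy_game n (\<sigma> n)) borel (early_score n) borel (late_score n)) \<and>
      \<not> weak_conv_m (\<lambda>n. distr (greedy_game n (\<sigma> n)) borel (total_score n))
           (W_law \<star> Zmax_law))"
proof (intro conjI exI[of _ stubborn] allI impI)
  fix \<sigma> :: "nat \<Rightarrow> strategy" assume "\<forall>n. non_stupid n (\<sigma> n)"
  then show "weak_conv_m (\<lambda>n. distr (greedy_game n (\<sigma> n)) borel (early_score n)) W_law"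
    "weak_conv_m (\<lambda>n. distr (greedy_game n (\<sigma> n)) borel (late_score n)) Zmax_law"
    by (auto intro: early_score_converges late_score_converges)
next
  show "non_stupid n (stubborn n)" for n by (rule non_stupid_stubborn)
next
  let ?G = "\<lambda>n. greedy_game n (stubborn n)"
  interpret Z: real_distribution Zmax_law by (rule real_distribution_Zmax_law)
  have "\<forall>\<^sub>F K in at_top. 0 < cdf Zmax_law K"
    using Z.cdf_lim_at_top_prob by (rule order_tendstoD) simp
  then obtain K where K: "0 < measure Zmax_law {..K}"
    by (auto simp: cdf_def eventually_at_top_linorder)
  have distr: "measure (distr (?G n) borel X) A = measure (?G n) (X -` A)"
    if "A \<in> sets borel" for n A and X :: "history \<Rightarrow> real"
    using that by (subst measure_distr) (auto simp: greedy_game_def)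
  have total: "\<forall>\<^sub>F n in sequentially. measure (?G n) (total_score n -` {..-(1/2)}) < c" if "0 < c" for c
    using order_tendstoD(2)[OF prob_total_score_stubborn_negative that]
    by (simp add: greedy_game_def vimage_def)
  show "\<forall>\<^sub>F n in sequentially. \<not> prob_space.indep_var (?G n) borel (early_score n) borel (late_score n)"
  proof -
    \<comment> \<open>Under independence the early score would be at most \<open>- K - 2\<close> and the late score at most
      \<open>K + 1\<close> simultaneously with a probability bounded away from \<open>0\<close>.\<close>
    define w where "w = measure W_law {..- K - 3} / 2"
    define z where "z = measure Zmax_law {..K} / 2"
    have wz: "0 < w" "0 < z" using W_law_atMost_pos K by (auto simp: w_def z_def)
    have "\<forall>\<^sub>F n in sequentially. w < measure (?G n) (early_score n -` {..- K - 2})"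
      using weak_conv_measure_atMost[OF real_distribution_game real_distribution_W_law early_score_converges[of stubborn], of "- K - 3" "- K - 2" w]
        W_law_atMost_pos[of "- K - 3"] by (simp add: w_def distr)
    moreover have "\<forall>\<^sub>F n in sequentially. z < measure (?G n) (late_score n -` {..K + 1})"
      using weak_conv_measure_atMost[OF real_distribution_game real_distribution_Zmax_law
          late_score_converges[OF non_stupid_stubborn], of K "K + 1" z] K
      by (simp add: z_def distr)
    moreover have "\<forall>\<^sub>F n in sequentially. measure (?G n) (total_score n -` {..-(1/2)}) < w * z"
      using wz by (intro total) simp
    ultimately show ?thesis
    proof eventually_elim
      case (elim n)
      interpret G: prob_space "?G n" unfolding greedy_game_def by (rule prob_space_measure_pmf)
      show ?case
      proof
        assume ind: "G.indep_var borel (early_score n) borel (late_score n)"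
        have "w * z \<le> measure (?G n) (early_score n -` {..- K - 2}) * measure (?G n) (late_score n -` {..K + 1})"
          using elim wz by (intro mult_mono) auto
        also have "\<dots> = measure (?G n) ((\<lambda>h. (early_score n h, late_score n h)) -` ({..- K - 2} \<times> {..K + 1}))"
          using G.indep_varD[OF ind, of "{..- K - 2}" "{..K + 1}"] by (simp add: greedy_game_def)
        also have "\<dots> \<le> measure (?G n) (total_score n -` {..-(1/2)})"
        proof (rule G.finite_measure_mono)
          show "(\<lambda>h. (early_score n h, late_score n h)) -` ({..- K - 2} \<times> {..K + 1}) \<subseteq> total_score n -` {..-(1/2)}"
          proof
            fix h assume "h \<in> (\<lambda>h. (early_score n h, late_score n h)) -` ({..- K - 2} \<times> {..K + 1})"
            moreover have "total_score n h = early_score n h + late_score n h"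
              by (simp add: total_score_def early_score_def late_score_def diff_divide_distrib)
            ultimately show "h \<in> total_score n -` {..-(1/2)}" by simp
          qed
        qed (simp add: greedy_game_def)
        finally show False using elim by simp
      qed
    qed
  qed
  show "\<not> weak_conv_m (\<lambda>n. distr (?G n) borel (total_score n)) (W_law \<star> Zmax_law)"
  proof
    assume conv: "weak_conv_m (\<lambda>n. distr (?G n) borel (total_score n)) (W_law \<star> Zmax_law)"
    define c where "c = measure (W_law \<star> Zmax_law) {..- 1} / 2"
    note conv_law = convolution_atMost_ge[OF real_distribution_W_law real_distribution_Zmax_law]
    have "0 < measure W_law {..- 1 - K} * measure Zmax_law {..K}"
      using W_law_atMost_pos K by simp
    also have "\<dots> \<le> measure (W_law \<star> Zmax_law) {..- 1 - K + K}" by (rule conv_law)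
    finally have c: "0 < c" by (simp add: c_def)
    then have "\<forall>\<^sub>F n in sequentially. c < measure (?G n) (total_score n -` {..-(1/2)})"
      using weak_conv_measure_atMost[OF real_distribution_game conv_law(1) conv, of "-1" "-(1/2)" c]
      by (simp add: c_def distr)
    with total[OF c] have "\<forall>\<^sub>F n::nat in sequentially. False"
      by eventually_elim simp
    then show False by simp
  qed
qed

end
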